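(* Let $\Sigma,\Delta,\Gamma\in\mathcal{G}_n$ be pairwise generalized cospectral. Suppose there exist $Q,Q_1\in\mathcal{Q}(\Sigma)$ with the same level $\ell$ such that $Q^{\rm T}S(\Sigma)Q=S(\Delta)$ and $Q_1^{\rm T}S(\Sigma)Q_1=S(\Gamma)$. Then $\Delta$ is isomorphic to $\Gamma$.
   Context: An oriented graph on vertices $v_1,\dots,v_n$ is a simple graph with each edge directed. Its skew-adjacency matrix $S=(s_{ij})$ has $s_{ij}=1$ if $(v_i,v_j)$ is an arc, $-1$ if $(v_j,v_i)$ is an arc, $0$ otherwise. Two oriented graphs $\Delta,\Gamma$ are isomorphic if $S(\Delta)=P^{\rm T}S(\Gamma)P$ for a permutation matrix $P$; they are generalized cospectral if their skew-adjacency matrices have the same spectrum and the matrices $J-I-S$ have the same spectrum ($J$ all-one, $I$ identity). With $e$ the all-one vector, $W(\Sigma)=[e,Se,\dots,S^{n-1}e]$ for $S=S(\Sigma)$. $\mathcal{G}_n$ is the set of $n$-vertex oriented graphs with $2^{-\lfloor n/2\rfloor}\det W(\Sigma)$ an odd square-free integer. A rational orthogonal matrix $Q$ is regular if $Qe=e$; its level is the least positive integer $k$ with $kQ$ integral. $\mathcal{Q}(\Sigma)$ is the set of regular rational orthogonal $Q$ with $Q^{\rm T}S(\Sigma)Q=S(\Delta)$ for some oriented graph $\Delta$ generalized cospectral with $\Sigma$. *)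

theory Defs
  imports "Jordan_Normal_Form.Determinant" "Jordan_Normal_Form.Char_Poly"
    "HOL-Computational_Algebra.Squarefree"
begin

definition oriented_graph :: "nat \<Rightarrow> (nat \<times> nat) set \<Rightarrow> bool" where
  "oriented_graph n A \<longleftrightarrow> A \<subseteq> {0..<n} \<times> {0..<n} \<and> (\<forall>i. (i, i) \<notin> A)
     \<and> (\<forall>i j. (i, j) \<in> A \<longrightarrow> (j, i) \<notin> A)"

definition skew_adj :: "nat \<Rightarrow> (nat \<times> nat) set \<Rightarrow> int mat" where
  "skew_adj n A = mat n n (\<lambda>(i, j). if (i, j) \<in> A then 1 else if (j, i) \<in> A then -1 else 0)"

definition all_ones_vec :: "nat \<Rightarrow> 'a :: one vec" where
  "all_ones_vec n = vec n (\<lambda>_. 1)"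

definition all_ones_mat :: "nat \<Rightarrow> 'a :: one mat" where
  "all_ones_mat n = mat n n (\<lambda>_. 1)"

definition permutation_mat :: "nat \<Rightarrow> 'a :: zero_neq_one mat \<Rightarrow> bool" where
  "permutation_mat n P \<longleftrightarrow> (\<exists>p. p permutes {0..<n} \<and>
      P = mat n n (\<lambda>(i, j). if p i = j then 1 else 0))"

definition iso_og :: "nat \<Rightarrow> (nat \<times> nat) set \<Rightarrow> (nat \<times> nat) set \<Rightarrow> bool" where
  "iso_og n D G \<longleftrightarrow> (\<exists>P :: int mat. permutation_mat n P \<and>
      skew_adj n D = transpose_mat P * skew_adj n G * P)"

text \<open>Same spectrum (with multiplicities) = same characteristic polynomial.\<close>
definition gen_cospectral :: "nat \<Rightarrow> (nat \<times> nat) set \<Rightarrow> (nat \<times> nat) set \<Rightarrow> bool" where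
  "gen_cospectral n D G \<longleftrightarrow>
     char_poly (skew_adj n D) = char_poly (skew_adj n G) \<and>
     char_poly (all_ones_mat n - 1\<^sub>m n - skew_adj n D) =
     char_poly (all_ones_mat n - 1\<^sub>m n - skew_adj n G)"

definition walk_mat :: "nat \<Rightarrow> (nat \<times> nat) set \<Rightarrow> int mat" where
  "walk_mat n A = mat n n (\<lambda>(i, j). ((skew_adj n A ^\<^sub>m j) *\<^sub>v all_ones_vec n) $ i)"

definition G_class :: "nat \<Rightarrow> (nat \<times> nat) set set" where
  "G_class n = {A. oriented_graph n A \<and> (2::int) ^ (n div 2) dvd det (walk_mat n A) \<and>
     odd (det (walk_mat n A) div 2 ^ (n div 2)) \<and>
     squarefree (det (walk_mat n A) div 2 ^ (n div 2))}"

definition rat_orthogonal :: "nat \<Rightarrow> rat mat \<Rightarrow> bool" where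
  "rat_orthogonal n Q \<longleftrightarrow> Q \<in> carrier_mat n n \<and> transpose_mat Q * Q = 1\<^sub>m n"

definition regular_mat :: "nat \<Rightarrow> rat mat \<Rightarrow> bool" where
  "regular_mat n Q \<longleftrightarrow> Q *\<^sub>v all_ones_vec n = all_ones_vec n"

definition integral_mat :: "rat mat \<Rightarrow> bool" where
  "integral_mat M \<longleftrightarrow> (\<forall>i < dim_row M. \<forall>j < dim_col M. M $$ (i, j) \<in> \<int>)"

definition level :: "rat mat \<Rightarrow> nat" where
  "level Q = (LEAST k::nat. 0 < k \<and> integral_mat (of_nat k \<cdot>\<^sub>m Q))"

definition Q_set :: "nat \<Rightarrow> (nat \<times> nat) set \<Rightarrow> rat mat set" where
  "Q_set n S = {Q. rat_orthogonal n Q \<and> regular_mat n Q \<and>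
     (\<exists>D. oriented_graph n D \<and> gen_cospectral n S D \<and>
        transpose_mat Q * map_mat of_int (skew_adj n S) * Q = map_mat of_int (skew_adj n D))}"

end

theory Submission
  imports Defs
begin

text \<open>
  Let \<open>W\<close> be the walk matrix of \<open>S\<close>, and let \<open>X = l Q\<close> and \<open>Y = l Q1\<close>, which are integral. Since
  \<open>Q\<^sup>T\<close> maps the walk vectors of \<open>S\<close> to those of \<open>D\<close>, all entries of \<open>W\<^sup>T X\<close> and \<open>W\<^sup>T Y\<close> are
  divisible by \<open>l\<close>. For an odd prime \<open>p\<close> dividing \<open>l\<close>, \<open>p\<^sup>2\<close> does not divide \<open>det W\<close>, so the kernel
  of \<open>W\<^sup>T\<close> modulo \<open>p\<close> is a line, spanned by some column \<open>z\<close> of \<open>X\<close>. All columns of \<open>X\<close> and \<open>Y\<close> are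
  multiples of \<open>z\<close> modulo \<open>p\<close>, and the relations \<open>X\<^sup>T X = Y\<^sup>T Y = l\<^sup>2 I\<close> lift this to
  \<open>Y\<^sup>T X\<close> being zero modulo \<open>p\<^sup>2\<close>. The level is odd (a parity argument with the self-orthogonal
  code generated by the walk vectors) and square-free, so \<open>Q1\<^sup>T Q\<close> is integral; being
  orthogonal and regular, it is a permutation matrix.
\<close>

subsection \<open>Determinants and linear independence modulo a prime\<close>

text \<open>Every Leibniz term takes exactly one entry from each row and each column, so row factors
  and column factors can be extracted simultaneously.\<close>

lemma prod_dvd_det:
  fixes A :: "'a :: comm_ring_1 mat"
  assumes A: "A \<in> carrier_mat n n"
    and dvd: "\<And>i j. i < n \<Longrightarrow> j < n \<Longrightarrow> f i * g j dvd A $$ (i, j)"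
  shows "(\<Prod>i = 0..<n. f i) * (\<Prod>j = 0..<n. g j) dvd det A"
  unfolding det_def'[OF A]
proof (intro dvd_sum dvd_mult)
  fix \<pi> assume "\<pi> \<in> {\<pi>. \<pi> permutes {0..<n}}"
  then have \<pi>: "\<pi> permutes {0..<n}" by simp
  have "(\<Prod>i = 0..<n. f i) * (\<Prod>j = 0..<n. g j) = (\<Prod>i = 0..<n. f i * g (\<pi> i))"
    using prod.permute[OF \<pi>, of g] by (simp add: prod.distrib o_def)
  also have "\<dots> dvd (\<Prod>i = 0..<n. A $$ (i, \<pi> i))"
    using permutes_in_image[OF \<pi>] by (intro prod_dvd_prod dvd) auto
  finally show "(\<Prod>i = 0..<n. f i) * (\<Prod>j = 0..<n. g j) dvd (\<Prod>i = 0..<n. A $$ (i, \<pi> i))" .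
qed

text \<open>Laplace expansion along the new column, whose cofactors are those of \<open>A\<close>.
  This is Cramer's rule without division, so it can be read modulo a prime.\<close>

lemma det_replace_col:
  fixes A :: "'a :: comm_ring_1 mat"
  assumes A: "A \<in> carrier_mat n n" and b: "b \<in> carrier_vec n" and k: "k < n"
  shows "det (replace_col A b k) = (adj_mat A *\<^sub>v b) $ k"
proof -
  have B: "replace_col A b k \<in> carrier_mat n n"
    using A by (simp add: replace_col_def)
  have "mat_delete (replace_col A b k) i k = mat_delete A i k" for i
    using A k by (intro eq_matI) (auto simp: replace_col_def mat_delete_def)
  then have "det (replace_col A b k) = (\<Sum>i<n. b $ i * cofactor A i k)"
    unfolding laplace_expansion_column[OF B k]
    using A k by (intro sum.cong) (auto simp: replace_col_def cofactor_def)
  also have "\<dots> = (adj_mat A *\<^sub>v b) $ k"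
    using A b k by (simp add: adj_mat_def scalar_prod_def lessThan_atLeast0 mult.commute)
  finally show ?thesis .
qed

text \<open>Steinitz exchange over the field of \<open>p\<close> elements, carried out on integer
  matrices: starting from the identity, one column at a time is exchanged while the determinant
  stays prime to \<open>p\<close>.\<close>

lemma extend_independent_mod_prime:
  fixes v :: "nat \<Rightarrow> int vec" and p :: int
  assumes p: "prime p" and v: "\<And>i. i < k \<Longrightarrow> v i \<in> carrier_vec n"
    and indep: "\<And>c. (\<And>r. r < n \<Longrightarrow> p dvd (\<Sum>i<k. c i * v i $ r)) \<Longrightarrow> \<forall>i<k. p dvd c i"
  obtains M j where "M \<in> carrier_mat n n" "\<not> p dvd det M" "inj_on j {..<k}"
    "\<And>i. i < k \<Longrightarrow> j i < n" "\<And>i. i < k \<Longrightarrow> col M (j i) = v i"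
proof -
  have "\<exists>M j. M \<in> carrier_mat n n \<and> \<not> p dvd det M \<and> inj_on j {..<k} \<and>
      (\<forall>i<k. j i < n \<and> col M (j i) = v i)"
    using v indep
  proof (induction k)
    case 0
    show ?case
      using p by (intro exI[of _ "1\<^sub>m n"]) (auto simp: not_prime_unit)
  next
    case (Suc k)
    have "\<forall>i<k. p dvd c i" if "\<And>r. r < n \<Longrightarrow> p dvd (\<Sum>i<k. c i * v i $ r)" for c
    proof -
      have "\<forall>i<Suc k. p dvd (c(k := 0)) i"
        using that by (intro Suc.prems(2)) simp
      then show ?thesis by (auto simp: less_Suc_eq split: if_splits)
    qed
    moreover have "v i \<in> carrier_vec n" if "i < k" for i
      using that by (intro Suc.prems(1)) simp
    ultimately obtain M j where M: "M \<in> carrier_mat n n" and det: "\<not> p dvd det M"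
      and inj: "inj_on j {..<k}" and j: "\<And>i. i < k \<Longrightarrow> j i < n"
      and col: "\<And>i. i < k \<Longrightarrow> col M (j i) = v i"
      using Suc.IH by blast
    define y where "y = adj_mat M *\<^sub>v v k"
    have vk: "v k \<in> carrier_vec n" using Suc.prems by simp
    have y: "y \<in> carrier_vec n" unfolding y_def using adj_mat(1)[OF M] vk by (rule mult_mat_vec_carrier)
    have "M *\<^sub>v y = (M * adj_mat M) *\<^sub>v v k"
      unfolding y_def using M adj_mat(1)[OF M] vk by (metis assoc_mult_mat_vec)
    then have My: "M *\<^sub>v y = det M \<cdot>\<^sub>v v k"
      using vk by (intro eq_vecI) (auto simp: adj_mat(2)[OF M])
    show ?case
    proof (cases "\<exists>r<n. r \<notin> j ` {..<k} \<and> \<not> p dvd y $ r")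
      case True
      then obtain r where r: "r < n" "r \<notin> j ` {..<k}" "\<not> p dvd y $ r" by blast
      let ?M = "replace_col M (v k) r"
      have "col ?M (j i) = v i" if "i < k" for i
        using M r j[OF that] that
        by (subst col[OF that, symmetric]) (auto simp: replace_col_def intro!: eq_vecI)
      moreover have "col ?M r = v k"
        using M r vk by (auto simp: replace_col_def)
      moreover have "det ?M = y $ r"
        unfolding y_def by (rule det_replace_col[OF M vk r(1)])
      moreover have "inj_on (\<lambda>i. if i = k then r else j i) {..<Suc k}"
        using inj r(2) by (auto simp: inj_on_def less_Suc_eq)
      moreover have "?M \<in> carrier_mat n n" using M by (simp add: replace_col_def)
      ultimately show ?thesis
        using r j by (intro exI[of _ ?M] exI[of _ "\<lambda>i. if i = k then r else j i"]) (auto simp: less_Suc_eq)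
    next
      case False
      \<comment> \<open>With no exchangeable column, \<open>v k\<close> depends on the earlier
        vectors modulo \<open>p\<close>. The coefficient \<open>- det M\<close> of this relation is
        prime to \<open>p\<close>, contradicting independence.\<close>
      define c where "c i = (if i < k then y $ j i else - det M)" for i
      have "p dvd (\<Sum>i<Suc k. c i * v i $ r)" if r: "r < n" for r
      proof -
        have "(\<Sum>i<k. c i * v i $ r) = (\<Sum>i<k. y $ j i * M $$ (r, j i))"
          using M r by (intro sum.cong) (auto simp: c_def col[symmetric] j)
        also have "\<dots> = (\<Sum>t\<in>j ` {..<k}. y $ t * M $$ (r, t))"
          by (simp add: sum.reindex[OF inj])
        finally have 1: "(\<Sum>i<k. c i * v i $ r) = (\<Sum>t\<in>j ` {..<k}. y $ t * M $$ (r, t))" .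
        have "det M * v k $ r = (M *\<^sub>v y) $ r" using My vk r by simp
        also have "\<dots> = (\<Sum>t\<in>{0..<n}. y $ t * M $$ (r, t))"
          using M y r by (simp add: scalar_prod_def mult.commute)
        also have "\<dots> = (\<Sum>t\<in>j ` {..<k}. y $ t * M $$ (r, t))
            + (\<Sum>t\<in>{0..<n} - j ` {..<k}. y $ t * M $$ (r, t))"
          using j by (subst add.commute, intro sum.subset_diff) auto
        finally have "(\<Sum>i<Suc k. c i * v i $ r)
            = - (\<Sum>t\<in>{0..<n} - j ` {..<k}. y $ t * M $$ (r, t))"
          using 1 by (simp add: c_def)
        moreover have "p dvd (\<Sum>t\<in>{0..<n} - j ` {..<k}. y $ t * M $$ (r, t))"
          using False by (intro dvd_sum) auto
        ultimately show ?thesis by simp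
      qed
      then have "p dvd c k" using Suc.prems(2) by blast
      with det show ?thesis by (simp add: c_def)
    qed
  qed
  with that show ?thesis by blast
qed

text \<open>The dimension bound for totally isotropic subspaces over the field of \<open>p\<close>
  elements. Once the vectors are columns of some \<open>M\<close> invertible modulo
  \<open>p\<close>, the Gram matrix of \<open>M\<close> has a zero block of size \<open>k\<close>
  modulo \<open>p\<close>; for \<open>2 * k > n\<close> this block makes its determinant, the square
  of \<open>det M\<close>, vanish modulo \<open>p\<close>.\<close>

lemma isotropic_independent_card_le:
  fixes v :: "nat \<Rightarrow> int vec" and p :: int
  assumes p: "prime p" and v: "\<And>i. i < k \<Longrightarrow> v i \<in> carrier_vec n"
    and orth: "\<And>i j. i < k \<Longrightarrow> j < k \<Longrightarrow> p dvd v i \<bullet> v j"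
    and indep: "\<And>c. (\<And>r. r < n \<Longrightarrow> p dvd (\<Sum>i<k. c i * v i $ r)) \<Longrightarrow> \<forall>i<k. p dvd c i"
  shows "2 * k \<le> n"
proof (rule ccontr)
  assume "\<not> 2 * k \<le> n"
  obtain M j where M: "M \<in> carrier_mat n n" and det: "\<not> p dvd det M"
    and inj: "inj_on j {..<k}" and j: "\<And>i. i < k \<Longrightarrow> j i < n"
    and col: "\<And>i. i < k \<Longrightarrow> col M (j i) = v i"
    by (rule extend_independent_mod_prime[OF p, of k v n]) (use v indep in blast)+
  define J where "J = j ` {..<k}"
  have J: "J \<subseteq> {0..<n}" "card J = k" using j inj by (auto simp: J_def card_image)
  let ?B = "transpose_mat M * M"
  have B: "?B \<in> carrier_mat n n" using M by simp
  have BJ: "p dvd ?B $$ (a, b)" if "a \<in> J" "b \<in> J" for a b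
    using that M orth j by (auto simp: J_def col)
  have "p dvd det ?B"
    unfolding det_def'[OF B]
  proof (intro dvd_sum dvd_mult)
    fix \<pi> assume "\<pi> \<in> {\<pi>. \<pi> permutes {0..<n}}"
    then have \<pi>: "\<pi> permutes {0..<n}" by simp
    \<comment> \<open>A permutation missing the block would map \<open>J\<close> injectively into
      its complement, which has only \<open>n - k < k\<close> elements.\<close>
    have "\<exists>i\<in>J. \<pi> i \<in> J"
    proof (rule ccontr)
      assume "\<not> (\<exists>i\<in>J. \<pi> i \<in> J)"
      then have "\<pi> ` J \<subseteq> {0..<n} - J" using J permutes_in_image[OF \<pi>] by blast
      then have "card (\<pi> ` J) \<le> card ({0..<n} - J)" by (intro card_mono) auto
      also have "\<dots> = n - k" using J finite_subset[OF J(1)] by (simp add: card_Diff_subset)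
      finally have "card (\<pi> ` J) \<le> n - k" .
      moreover have "card (\<pi> ` J) = k"
        using J(2) card_image[OF permutes_inj_on[OF \<pi>]] by simp
      moreover have "k \<le> n" using card_mono[OF _ J(1)] J(2) by simp
      ultimately show False using \<open>\<not> 2 * k \<le> n\<close> by linarith
    qed
    then obtain i where i: "i \<in> J" "\<pi> i \<in> J" by blast
    then have "?B $$ (i, \<pi> i) dvd (\<Prod>i = 0..<n. ?B $$ (i, \<pi> i))"
      using J by (intro dvd_prodI) auto
    with BJ[OF i] show "p dvd (\<Prod>i = 0..<n. ?B $$ (i, \<pi> i))" by (rule dvd_trans)
  qed
  moreover have "det ?B = det M * det M"
    using M by (simp add: det_mult[of _ n] det_transpose)
  ultimately show False using p det by (simp add: prime_dvd_mult_iff)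
qed

text \<open>If \<open>x\<close> and \<open>y\<close> were independent modulo \<open>p\<close>, they
  would be columns of some \<open>M\<close> invertible modulo \<open>p\<close>; two rows of
  \<open>transpose_mat M * W\<close> would then be divisible by \<open>p\<close>, so
  \<open>p^2\<close> would divide \<open>det W\<close>. The entry at \<open>s\<close> makes
  \<open>x\<close> a generator of the kernel line.\<close>

lemma left_kernel_mod_prime:
  fixes W :: "int mat" and p :: int
  assumes p: "prime p" and W: "W \<in> carrier_mat n n" and det: "\<not> p\<^sup>2 dvd det W"
    and x: "x \<in> carrier_vec n" and y: "y \<in> carrier_vec n"
    and xW: "\<And>j. j < n \<Longrightarrow> p dvd x \<bullet> col W j" and yW: "\<And>j. j < n \<Longrightarrow> p dvd y \<bullet> col W j"
    and s: "s < n" "\<not> p dvd x $ s"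
  obtains c where "\<And>r. r < n \<Longrightarrow> p dvd y $ r - c * x $ r"
proof -
  define v where "v i = (if i = 0 then x else y)" for i :: nat
  have sum2: "(\<Sum>i<2. h i) = h 0 + h (Suc 0)" for h :: "nat \<Rightarrow> int"
    by (simp add: numeral_2_eq_2)
  have "\<not> (\<forall>c. (\<forall>r<n. p dvd (\<Sum>i<2. c i * v i $ r)) \<longrightarrow> (\<forall>i<2. p dvd c i))"
  proof
    assume indep: "\<forall>c. (\<forall>r<n. p dvd (\<Sum>i<2. c i * v i $ r)) \<longrightarrow> (\<forall>i<2. p dvd c i)"
    obtain M j where M: "M \<in> carrier_mat n n" and detM: "\<not> p dvd det M"
      and inj: "inj_on j {..<2::nat}" and j: "\<And>i. i < 2 \<Longrightarrow> j i < n"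
      and col: "\<And>i. i < 2 \<Longrightarrow> col M (j i) = v i"
      by (rule extend_independent_mod_prime[OF p, of 2 v n])
        (use x y indep that in \<open>auto simp: v_def\<close>)
    define J where "J = j ` {..<2}"
    have J: "J \<subseteq> {0..<n}" "card J = 2" using j inj by (auto simp: J_def card_image)
    let ?B = "transpose_mat M * W"
    have "(\<Prod>i = 0..<n. if i \<in> J then p else 1) * (\<Prod>j = 0..<n. 1) dvd det ?B"
    proof (rule prod_dvd_det)
      show "?B \<in> carrier_mat n n" using M W by simp
      show "(if i \<in> J then p else 1) * 1 dvd ?B $$ (i, t)" if "i < n" "t < n" for i t
        using that M W xW yW col by (auto simp: J_def v_def)
    qed
    moreover have "(\<Prod>i = 0..<n. if i \<in> J then p else 1) = p\<^sup>2"
      using J by (subst prod.inter_restrict[symmetric]) (auto simp: Int_absorb1)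
    moreover have "det ?B = det M * det W"
      using M W by (simp add: det_mult[of _ n] det_transpose)
    ultimately have "p\<^sup>2 dvd det M * det W" by simp
    moreover have "coprime (p\<^sup>2) (det M)" using p detM by (simp add: prime_imp_coprime)
    ultimately show False using det by (simp add: coprime_dvd_mult_right_iff)
  qed
  then obtain c i where c: "\<And>r. r < n \<Longrightarrow> p dvd c 0 * x $ r + c (Suc 0) * y $ r"
    and i: "i < 2" "\<not> p dvd c i"
    by (auto simp: sum2 v_def)
  \<comment> \<open>If the coefficient of \<open>y\<close> vanished modulo \<open>p\<close>, the
    entry at \<open>s\<close> would make the other coefficient vanish too.\<close>
  have c1: "\<not> p dvd c (Suc 0)"
  proof
    assume *: "p dvd c (Suc 0)"
    then have "p dvd c 0 * x $ s" using c[OF s(1)] by (simp add: dvd_add_left_iff)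
    then have "p dvd c 0" using p s(2) by (simp add: prime_dvd_mult_iff)
    with * i show False by (auto simp: less_2_cases_iff)
  qed
  then have "coprime (c (Suc 0)) p" using p by (simp add: coprime_commute prime_imp_coprime)
  \<comment> \<open>\<open>d\<close> inverts the coefficient of \<open>y\<close> modulo
    \<open>p\<close>, so the relation can be solved for \<open>y\<close>.\<close>
  then obtain d e where d: "d * c (Suc 0) + e * p = 1" using bezout_int[of "c (Suc 0)" p] by auto
  show ?thesis
  proof (rule that[of "- d * c 0"])
    fix r assume r: "r < n"
    have "y $ r - (- d * c 0) * x $ r
        = d * (c 0 * x $ r + c (Suc 0) * y $ r) + (1 - d * c (Suc 0)) * y $ r"
      by (simp add: algebra_simps)
    also have "1 - d * c (Suc 0) = p * e" using d by (simp add: algebra_simps)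
    finally show "p dvd y $ r - (- d * c 0) * x $ r"
      using c[OF r] by simp
  qed
qed

subsection \<open>Walk vectors of a skew-symmetric matrix modulo 2\<close>

lemma all_ones_vec_carrier [simp]: "all_ones_vec n \<in> carrier_vec n"
  by (simp add: all_ones_vec_def)

text \<open>The Krylov sequence of \<open>x\<close>. The start is arbitrary because the parity
  argument iterates \<open>A\<close> on columns of \<open>X\<close> as well as on the all-one
  vector.\<close>

definition orbit :: "'a :: comm_ring_1 mat \<Rightarrow> 'a vec \<Rightarrow> nat \<Rightarrow> 'a vec" where
  "orbit A x k = (A ^\<^sub>m k) *\<^sub>v x"

lemma orbit_carrier [simp]:
  "A \<in> carrier_mat n n \<Longrightarrow> x \<in> carrier_vec n \<Longrightarrow> orbit A x k \<in> carrier_vec n"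
  unfolding orbit_def by (rule mult_mat_vec_carrier) auto

lemma dim_orbit [simp]: "dim_vec (orbit A x k) = dim_row A"
  by (induction k) (auto simp: orbit_def)

lemma orbit_0 [simp]: "A \<in> carrier_mat n n \<Longrightarrow> x \<in> carrier_vec n \<Longrightarrow> orbit A x 0 = x"
  by (simp add: orbit_def)

lemma orbit_Suc:
  assumes A: "A \<in> carrier_mat n n" and x: "x \<in> carrier_vec n"
  shows "orbit A x (Suc k) = A *\<^sub>v orbit A x k"
proof -
  have "A ^\<^sub>m k * A = A * A ^\<^sub>m k"
  proof (induction k)
    case (Suc k)
    then show ?case using A by (simp add: assoc_mult_mat[of _ n n _ n _ n])
  qed (use A in simp)
  then show ?thesis
    using A x by (simp add: orbit_def assoc_mult_mat_vec[of _ n n _ n])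
qed

lemma orbit_orbit:
  assumes A: "A \<in> carrier_mat n n" and x: "x \<in> carrier_vec n"
  shows "orbit A (orbit A x i) k = orbit A x (i + k)"
  using assms by (induction k) (auto simp: orbit_Suc)

lemma mult_mat_vec_lincomb:
  fixes A :: "'a :: comm_ring_1 mat"
  assumes A: "A \<in> carrier_mat n n" and u: "\<And>i. i \<in> I \<Longrightarrow> u i \<in> carrier_vec n"
  shows "A *\<^sub>v vec n (\<lambda>r. \<Sum>i\<in>I. c i * u i $ r) = vec n (\<lambda>r. \<Sum>i\<in>I. c i * (A *\<^sub>v u i) $ r)"
proof (rule eq_vecI)
  fix r assume "r < dim_vec (vec n (\<lambda>r. \<Sum>i\<in>I. c i * (A *\<^sub>v u i) $ r))"
  then have r: "r < n" by simp
  have "(A *\<^sub>v vec n (\<lambda>r. \<Sum>i\<in>I. c i * u i $ r)) $ r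
      = (\<Sum>t = 0..<n. \<Sum>i\<in>I. A $$ (r, t) * (c i * u i $ t))"
    using A r by (simp add: scalar_prod_def sum_distrib_left)
  also have "\<dots> = (\<Sum>i\<in>I. \<Sum>t = 0..<n. A $$ (r, t) * (c i * u i $ t))" by (rule sum.swap)
  also have "\<dots> = (\<Sum>i\<in>I. c i * (A *\<^sub>v u i) $ r)"
  proof (intro sum.cong refl)
    fix i assume "i \<in> I"
    then show "(\<Sum>t = 0..<n. A $$ (r, t) * (c i * u i $ t)) = c i * (A *\<^sub>v u i) $ r"
      using A r carrier_vecD[OF u]
      by (simp add: scalar_prod_def sum_distrib_left mult.left_commute)
  qed
  finally show "(A *\<^sub>v vec n (\<lambda>r. \<Sum>i\<in>I. c i * u i $ r)) $ r
      = vec n (\<lambda>r. \<Sum>i\<in>I. c i * (A *\<^sub>v u i) $ r) $ r"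
    using r by simp
qed (use A in simp)

lemma scalar_prod_lincomb:
  fixes u :: "'i \<Rightarrow> 'a :: comm_ring_1 vec"
  assumes u: "\<And>i. i \<in> I \<Longrightarrow> u i \<in> carrier_vec n"
  shows "vec n (\<lambda>r. \<Sum>i\<in>I. c i * u i $ r) \<bullet> vec n (\<lambda>r. \<Sum>i\<in>I. c i * u i $ r)
    = (\<Sum>i\<in>I. \<Sum>j\<in>I. c i * c j * (u i \<bullet> u j))"
proof -
  have "vec n (\<lambda>r. \<Sum>i\<in>I. c i * u i $ r) \<bullet> vec n (\<lambda>r. \<Sum>i\<in>I. c i * u i $ r)
      = (\<Sum>r = 0..<n. \<Sum>i\<in>I. \<Sum>j\<in>I. (c i * u i $ r) * (c j * u j $ r))"
    by (simp add: scalar_prod_def sum_product)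
  also have "\<dots> = (\<Sum>i\<in>I. \<Sum>j\<in>I. \<Sum>r = 0..<n. (c i * u i $ r) * (c j * u j $ r))"
    by (subst sum.swap, intro sum.cong refl, rule sum.swap)
  also have "\<dots> = (\<Sum>i\<in>I. \<Sum>j\<in>I. c i * c j * (u i \<bullet> u j))"
    using carrier_vecD[OF u] by (intro sum.cong refl) (simp add: scalar_prod_def sum_distrib_left ac_simps)
  finally show ?thesis .
qed

text \<open>An integer and its square have the same parity, so modulo 2 the squared norm is a linear
  function.\<close>

lemma even_scalar_prod_self_iff:
  fixes x :: "int vec"
  assumes "x \<in> carrier_vec n"
  shows "even (x \<bullet> x) \<longleftrightarrow> even (all_ones_vec n \<bullet> x)"
proof -
  have "x \<bullet> x - all_ones_vec n \<bullet> x = (\<Sum>i = 0..<n. x $ i * x $ i - x $ i)"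
    using assms by (simp add: scalar_prod_def all_ones_vec_def sum_subtractf)
  moreover have "even (\<Sum>i = 0..<n. x $ i * x $ i - x $ i)"
    by (intro dvd_sum) auto
  ultimately show ?thesis by (metis even_diff_iff even_add)
qed

text \<open>Off-diagonal terms occur in equal pairs of even numbers: modulo 4 such a quadratic form
  reduces to its diagonal.\<close>

lemma four_dvd_double_sum_minus_diag:
  fixes f :: "nat \<Rightarrow> nat \<Rightarrow> int"
  assumes "\<And>i j. i < k \<Longrightarrow> j < k \<Longrightarrow> f i j = f j i"
    and "\<And>i j. i < k \<Longrightarrow> j < k \<Longrightarrow> i \<noteq> j \<Longrightarrow> even (f i j)"
  shows "4 dvd (\<Sum>i<k. \<Sum>j<k. f i j) - (\<Sum>i<k. f i i)"
  using assms
proof (induction k)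
  case (Suc k)
  have "(\<Sum>i<k. f i k) = (\<Sum>j<k. f k j)" by (intro sum.cong Suc.prems(1)) auto
  then have "(\<Sum>i<Suc k. \<Sum>j<Suc k. f i j) - (\<Sum>i<Suc k. f i i)
      = ((\<Sum>i<k. \<Sum>j<k. f i j) - (\<Sum>i<k. f i i)) + 2 * (\<Sum>j<k. f k j)"
    by (simp add: sum.distrib)
  moreover have "even (\<Sum>j<k. f k j)" by (intro dvd_sum Suc.prems(2)) auto
  then have "4 dvd 2 * (\<Sum>j<k. f k j)" by auto
  moreover have "4 dvd (\<Sum>i<k. \<Sum>j<k. f i j) - (\<Sum>i<k. f i i)"
    using Suc.prems by (intro Suc.IH) auto
  ultimately show ?case by simp
qed simp

section \<open>Moments and parity of the walk vectors\<close>

context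
  fixes n :: nat and A :: "int mat"
  assumes A: "A \<in> carrier_mat n n" and skew: "transpose_mat A = - A"
begin

abbreviation walk :: "nat \<Rightarrow> int vec" where
  "walk \<equiv> orbit A (all_ones_vec n)"

abbreviation moment :: "nat \<Rightarrow> int" where
  "moment k \<equiv> all_ones_vec n \<bullet> walk k"

lemma walk_carrier [simp]: "walk k \<in> carrier_vec n"
  using A by simp

lemma skew_scalar_prod:
  assumes "x \<in> carrier_vec n" "y \<in> carrier_vec n"
  shows "(A *\<^sub>v x) \<bullet> y = - (x \<bullet> (A *\<^sub>v y))"
proof -
  have "x \<bullet> (A *\<^sub>v y) = (transpose_mat A *\<^sub>v x) \<bullet> y"
    using A assms by (simp add: transpose_vec_mult_scalar)
  also have "\<dots> = - ((A *\<^sub>v x) \<bullet> y)"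
    using A assms by (simp add: skew)
  finally show ?thesis by simp
qed

text \<open>Each transfer of \<open>A\<close> to the other factor costs a sign. Up to signs, the
  Gram matrix of the walk vectors is thus a Hankel matrix of moments.\<close>

lemma walk_scalar_prod: "walk i \<bullet> walk j = (-1) ^ i * moment (i + j)"
proof (induction i arbitrary: j)
  case 0
  show ?case using A by simp
next
  case (Suc i)
  have "walk (Suc i) \<bullet> walk j = - (walk i \<bullet> walk (Suc j))"
    using A by (simp add: orbit_Suc skew_scalar_prod)
  also have "\<dots> = (-1) ^ Suc i * moment (Suc i + j)"
    by (simp add: Suc.IH)
  finally show ?case .
qed

text \<open>Symmetry of the scalar product and the sign rule give
  \<open>moment k = - moment k\<close>.\<close>

lemma moment_odd: 
  assumes "odd k"
  shows "moment k = 0"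
proof -
  have "walk 0 \<bullet> walk k = walk k \<bullet> walk 0" by (rule comm_scalar_prod) (rule walk_carrier)+
  with assms show ?thesis unfolding walk_scalar_prod by simp
qed

text \<open>For \<open>k = 2 * m\<close> the moment is, up to sign, the squared norm of
  \<open>walk m\<close>, which has the parity of \<open>moment m\<close>; so the index descends by
  halving.\<close>

lemma even_moment: "k > 0 \<Longrightarrow> even (moment k)"
proof (induction k rule: less_induct)
  case (less k)
  show ?case
  proof (cases "odd k")
    case True
    then show ?thesis by (simp add: moment_odd)
  next
    case False
    then obtain m where k: "k = m + m" by (metis evenE mult_2)
    have "even (moment m)" using less k by simp
    then have "even (walk m \<bullet> walk m)" by (simp add: even_scalar_prod_self_iff[of _ n])
    then show ?thesis by (simp add: walk_scalar_prod k)
  qed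
qed

text \<open>In the excluded case \<open>i = j = 0\<close> with \<open>n\<close> odd, the product is
  \<open>n\<close> itself.\<close>

lemma even_walk_scalar_prod:
  assumes "i + j > 0 \<or> even n"
  shows "even (walk i \<bullet> walk j)"
proof (cases "i + j > 0")
  case True
  then show ?thesis by (simp add: walk_scalar_prod even_moment)
next
  case False
  with assms A show ?thesis by (simp add: all_ones_vec_def scalar_prod_def)
qed

text \<open>The power of 2 in the Gram determinant is already accounted for by its even rows,
  so a kernel vector modulo 4 with an odd entry would contribute one factor 2 too many.\<close>

lemma walk_gram_kernel_even:
  assumes det: "det (mat n n (\<lambda>(i, j). walk j $ i)) = 2 ^ (n div 2) * d" and d: "odd d"
    and z: "\<And>k. k < n \<Longrightarrow> 4 dvd (\<Sum>j = 0..<n. z j * (walk k \<bullet> walk j))"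
    and r: "r < n"
  shows "even (z r)"
proof -
  let ?W = "mat n n (\<lambda>(i, j). walk j $ i)"
  define B where "B = transpose_mat ?W * ?W"
  let ?z = "vec n z"
  let ?C = "replace_col B (B *\<^sub>v ?z) r"
  let ?o = "n mod 2"
  have B: "B \<in> carrier_mat n n" unfolding B_def by (intro mult_carrier_mat[of _ n n]) auto
  have "col ?W j = walk j" if "j < n" for j
    using that A by (intro eq_vecI) auto
  then have Bij: "B $$ (i, j) = walk i \<bullet> walk j" if "i < n" "j < n" for i j
    using that by (simp add: B_def)
  have Bz: "(B *\<^sub>v ?z) $ k = (\<Sum>j = 0..<n. z j * (walk k \<bullet> walk j))" if "k < n" for k
    using that B by (simp add: scalar_prod_def[of "row B k"] Bij mult.commute)
  have detB: "det B = 2 ^ (2 * (n div 2)) * (d * d)"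
    unfolding B_def using det
    by (simp add: det_mult[of _ n] det_transpose[of _ n] mult_2 power_add ac_simps)
  have C: "?C \<in> carrier_mat n n" using B by (simp add: replace_col_def)
  have Cij: "?C $$ (i, j) = (if j = r then (B *\<^sub>v ?z) $ i else B $$ (i, j))"
    if "i < n" "j < n" for i j
    using that B by (simp add: replace_col_def)
  \<comment> \<open>By Cramer's rule \<open>det ?C = z r * det B\<close>. Every row of
    \<open>B\<close> is even, except row 0 for odd \<open>n\<close>; in column \<open>r\<close>,
    divisibility by 4 leaves room for one further factor 2.\<close>
  have "(\<Prod>i = 0..<n. if i < ?o then 1 else 2) * (\<Prod>j = 0..<n. if j = r then 2 else 1) dvd det ?C"
  proof (rule prod_dvd_det[OF C])
    fix i j assume ij: "i < n" "j < n"
    show "(if i < ?o then 1 else 2) * (if j = r then 2 else 1) dvd ?C $$ (i, j)"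
    proof (cases "j = r")
      case True
      have "(if i < ?o then 1 else 2) * 2 dvd (4 :: int)" by simp
      also have "4 dvd ?C $$ (i, j)" using True z[OF ij(1)] ij by (simp add: Cij Bz)
      finally show ?thesis using True by simp
    next
      case False
      have "even (walk i \<bullet> walk j)" if "\<not> i < ?o"
        using that by (intro even_walk_scalar_prod) (auto simp: mod_2_eq_odd split: if_splits)
      then show ?thesis using False ij by (simp add: Cij Bij)
    qed
  qed
  moreover have "(\<Prod>j = 0..<n. if j = r then 2 else 1 :: int) = 2"
    using r by (simp add: prod.delta)
  moreover have "(\<Prod>i = 0..<n. if i < ?o then 1 else 2 :: int) = 2 ^ (2 * (n div 2))"
  proof -
    have "(\<Prod>i = 0..<n. if i < ?o then 1 else 2 :: int) = (\<Prod>i = ?o..<n. 2)"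
      by (rule prod.mono_neutral_cong_right) auto
    also have "\<dots> = 2 ^ (2 * (n div 2))" by (simp add: minus_mod_eq_mult_div)
    finally show ?thesis .
  qed
  moreover have "det ?C = z r * (2 ^ (2 * (n div 2)) * (d * d))"
    using r cramer_lemma_mat[OF B, of ?z r] by (simp add: detB)
  ultimately have "2 ^ (2 * (n div 2)) * 2 dvd 2 ^ (2 * (n div 2)) * (z r * (d * d))"
    by (simp add: ac_simps)
  then have "2 dvd z r * (d * d)" by (subst (asm) dvd_mult_cancel_left) simp
  then show ?thesis using d by simp
qed

text \<open>If \<open>q\<close> had an odd entry, it would extend the \<open>n div 2\<close> walk vectors starting at
  index \<open>n mod 2\<close> to a family that is orthogonal and linearly independent modulo 2,
  which is too large for dimension \<open>n\<close>.\<close>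

lemma even_of_isotropic_orbit:
  assumes det: "det (mat n n (\<lambda>(i, j). walk j $ i)) = 2 ^ (n div 2) * d" and d: "odd d"
    and q: "q \<in> carrier_vec n" and qW: "\<And>k. k < n \<Longrightarrow> even (q \<bullet> walk k)"
    and qq: "\<And>k. 4 dvd orbit A q k \<bullet> orbit A q k"
    and r: "r < n"
  shows "even (q $ r)"
proof -
  \<comment> \<open>\<open>o'\<close> drops \<open>walk 0\<close> when \<open>n\<close> is odd,
    because its squared norm \<open>n\<close> is then odd.\<close>
  define o' K where "o' = n mod 2" and "K = n div 2"
  have n: "n = 2 * K + o'" and o2: "o' < 2" by (simp_all add: o'_def K_def)
  have ev: "i + o' > 0 \<or> even n" for i by (auto simp: o'_def odd_iff_mod_2_eq_one)
  define v where "v i = (if i < K then walk (i + o') else q)" for i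
  have "\<not> (\<forall>c. (\<forall>r<n. 2 dvd (\<Sum>i<Suc K. c i * v i $ r)) \<longrightarrow> (\<forall>i<Suc K. 2 dvd c i))"
  proof
    assume indep: "\<forall>c. (\<forall>r<n. 2 dvd (\<Sum>i<Suc K. c i * v i $ r)) \<longrightarrow> (\<forall>i<Suc K. 2 dvd c i)"
    have "2 * Suc K \<le> n"
    proof (rule isotropic_independent_card_le[of "2 :: int" "Suc K" v n])
      show "v i \<in> carrier_vec n" for i using q by (simp add: v_def)
      show "2 dvd v i \<bullet> v j" if "i < Suc K" "j < Suc K" for i j
      proof -
        have 1: "even (q \<bullet> q)" using qq[of 0] A q by auto
        have 2: "even (q \<bullet> walk (i + o'))" if "i < K" for i
          using that n by (intro qW) auto
        then have 3: "even (walk (i + o') \<bullet> q)" if "i < K" for i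
          using that comm_scalar_prod[OF q walk_carrier] by metis
        have 4: "even (walk (i + o') \<bullet> walk (j + o'))"
          using ev[of "i + j"] by (intro even_walk_scalar_prod) auto
        show ?thesis using 1 2 3 4 by (simp add: v_def)
      qed
      show "\<forall>i<Suc K. 2 dvd c i" if "\<And>r. r < n \<Longrightarrow> 2 dvd (\<Sum>i<Suc K. c i * v i $ r)" for c
        using indep that by blast
    qed simp
    with n o2 show False by simp
  qed
  \<comment> \<open>It remains to show that \<open>c i\<close> is even for all \<open>i < K\<close>:
    then \<open>c K\<close> must be odd, and the relation forces the entries of \<open>q\<close> to
    be even.\<close>
  then obtain c where c: "\<And>r. r < n \<Longrightarrow> even ((\<Sum>i<K. c i * walk (i + o') $ r) + c K * q $ r)"
    and odd: "\<exists>i<Suc K. odd (c i)"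
    by (auto simp: v_def)
  define x where "x = vec n (\<lambda>r. \<Sum>i<K. c i * walk (i + o') $ r)"
  define y where "y = vec n (\<lambda>r. (x $ r + c K * q $ r) div 2)"
  have x: "x \<in> carrier_vec n" and y: "y \<in> carrier_vec n" by (simp_all add: x_def y_def)
  have x_eq: "x = 2 \<cdot>\<^sub>v y - c K \<cdot>\<^sub>v q"
    using c q by (intro eq_vecI) (auto simp: x_def y_def)
  \<comment> \<open>By \<open>x_eq\<close>, the squared norm of \<open>orbit A x k\<close> is
    divisible by 4. Expanded in walk vectors, it reduces modulo 4 to its diagonal; there each signed
    square of \<open>c i\<close> may be replaced by \<open>c i\<close>, since both have the same
    parity and the moments are even. The quadratic condition becomes linear in
    \<open>c\<close>.\<close>
  have "4 dvd (\<Sum>i<K. c i * moment (2 * (i + o' + k)))" for k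
  proof -
    have "orbit A x k = 2 \<cdot>\<^sub>v orbit A y k - c K \<cdot>\<^sub>v orbit A q k"
      unfolding x_eq orbit_def using A y q
      by (subst mult_minus_distrib_mat_vec[of _ n n]) auto
    then have "orbit A x k \<bullet> orbit A x k = 4 * (orbit A y k \<bullet> orbit A y k)
        - 4 * (c K * (orbit A y k \<bullet> orbit A q k)) + c K * c K * (orbit A q k \<bullet> orbit A q k)"
      using A y q comm_scalar_prod[of "orbit A q k" n "orbit A y k"]
      by (simp add: scalar_prod_minus_distrib[of _ n] minus_scalar_prod_distrib[of _ n]
          smult_scalar_prod_distrib[of _ n] scalar_prod_smult_distrib[of _ n] algebra_simps)
    then have "4 dvd orbit A x k \<bullet> orbit A x k" using qq[of k] by simp
    moreover have "orbit A x k = vec n (\<lambda>r. \<Sum>i<K. c i * walk (i + o' + k) $ r)"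
      unfolding x_def orbit_def[of A "vec n _"] using A
      by (subst mult_mat_vec_lincomb) (auto simp: orbit_def[symmetric] orbit_orbit[of _ n])
    ultimately have 1: "4 dvd (\<Sum>i<K. \<Sum>j<K. c i * c j * (walk (i + o' + k) \<bullet> walk (j + o' + k)))"
      by (simp add: scalar_prod_lincomb)
    have 2: "4 dvd (\<Sum>i<K. \<Sum>j<K. c i * c j * (walk (i + o' + k) \<bullet> walk (j + o' + k)))
        - (\<Sum>i<K. c i * c i * (walk (i + o' + k) \<bullet> walk (i + o' + k)))"
    proof (rule four_dvd_double_sum_minus_diag)
      fix i j :: nat assume "i \<noteq> j"
      then show "even (c i * c j * (walk (i + o' + k) \<bullet> walk (j + o' + k)))"
        by (intro dvd_mult even_walk_scalar_prod) auto
    qed (simp add: comm_scalar_prod[of _ n] mult.commute)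
    have "4 dvd (\<Sum>i<K. c i * c i * (walk (i + o' + k) \<bullet> walk (i + o' + k))
        - c i * moment (2 * (i + o' + k)))"
    proof (intro dvd_sum)
      fix i :: nat
      let ?m = "moment (2 * (i + o' + k))"
      have eq: "walk (i + o' + k) \<bullet> walk (i + o' + k) = (-1) ^ (i + o' + k) * ?m"
        unfolding walk_scalar_prod mult_2 ..
      have "even (walk (i + o' + k) \<bullet> walk (i + o' + k))"
        using ev[of i] by (intro even_walk_scalar_prod) auto
      then have "even ?m" by (simp add: eq)
      moreover have "even (c i * (-1) ^ (i + o' + k) * c i - c i)" by simp
      ultimately have "2 * 2 dvd (c i * (-1) ^ (i + o' + k) * c i - c i) * ?m"
        by (rule mult_dvd_mono[rotated])
      then show "4 dvd c i * c i * (walk (i + o' + k) \<bullet> walk (i + o' + k)) - c i * ?m"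
        unfolding eq by (simp add: algebra_simps)
    qed
    with 1 2 show ?thesis
      unfolding sum_subtractf by (metis (no_types, lifting) dvd_diff_right_iff dvd_diff_left_iff)
  qed
  note mom = this
  have "even (c i)" if i: "i < K" for i
  proof -
    \<comment> \<open>Placing \<open>c i\<close> at index \<open>2 * (i + o')\<close> yields a
      kernel vector modulo 4 of the walk Gram matrix: row \<open>2 * m\<close> is the condition
      \<open>mom\<close> for \<open>m\<close>, and odd rows hold because odd moments vanish.\<close>
    define z where "z j = (if even j \<and> 2 * o' \<le> j then c (j div 2 - o') else 0)" for j
    have "even (z (2 * (i + o')))"
    proof (rule walk_gram_kernel_even[OF det d])
      show "2 * (i + o') < n" using i n o2 by auto
      fix k assume "k < n"
      have "(\<Sum>j = 0..<n. z j * (walk k \<bullet> walk j))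
          = (\<Sum>j\<in>(\<lambda>i. 2 * (i + o')) ` {..<K}. z j * (walk k \<bullet> walk j))"
      proof (rule sum.mono_neutral_right)
        show "(\<lambda>i. 2 * (i + o')) ` {..<K} \<subseteq> {0..<n}" using n o2 by auto
        show "\<forall>j\<in>{0..<n} - (\<lambda>i. 2 * (i + o')) ` {..<K}. z j * (walk k \<bullet> walk j) = 0"
        proof
          fix j assume j: "j \<in> {0..<n} - (\<lambda>i. 2 * (i + o')) ` {..<K}"
          have "z j = 0"
          proof (rule ccontr)
            assume "z j \<noteq> 0"
            then have "even j" "2 * o' \<le> j" by (auto simp: z_def split: if_splits)
            then have "j = 2 * ((j div 2 - o') + o')" "j div 2 - o' < K"
              using j n o2 by auto
            with j show False by blast
          qed
          then show "z j * (walk k \<bullet> walk j) = 0" by simp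
        qed
      qed simp
      also have "\<dots> = (\<Sum>i<K. c i * (walk k \<bullet> walk (2 * (i + o'))))"
        by (subst sum.reindex) (auto simp: inj_on_def z_def)
      also have "\<dots> = (-1) ^ k * (\<Sum>i<K. c i * moment (k + 2 * (i + o')))"
        by (simp add: walk_scalar_prod sum_distrib_left mult.left_commute)
      finally have *: "(\<Sum>j = 0..<n. z j * (walk k \<bullet> walk j))
          = (-1) ^ k * (\<Sum>i<K. c i * moment (k + 2 * (i + o')))" .
      show "4 dvd (\<Sum>j = 0..<n. z j * (walk k \<bullet> walk j))"
      proof (cases "even k")
        case True
        then obtain m where "k = 2 * m" by blast
        then show ?thesis using mom[of m] unfolding * by (simp add: algebra_simps)
      next
        case False
        then show ?thesis by (simp add: * moment_odd)
      qed
    qed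
    then show ?thesis by (simp add: z_def)
  qed
  then have "odd (c K)" and "even (\<Sum>i<K. c i * walk (i + o') $ r)"
    using odd by (auto simp: less_Suc_eq intro!: dvd_sum)
  with c[OF r] show ?thesis by simp
qed

end

subsection \<open>Odd primes, permutation matrices and the level\<close>

lemma scalar_prod_perturbed:
  fixes z :: "'a :: comm_ring_1 vec"
  assumes z: "z \<in> carrier_vec n" and w: "w \<in> carrier_vec n" and w': "w' \<in> carrier_vec n"
  shows "(a \<cdot>\<^sub>v z + p \<cdot>\<^sub>v w) \<bullet> (b \<cdot>\<^sub>v z + p \<cdot>\<^sub>v w')
    = a * b * (z \<bullet> z) + p * (a * (z \<bullet> w') + b * (z \<bullet> w)) + p\<^sup>2 * (w \<bullet> w')"
  using assms comm_scalar_prod[OF w z]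
  by (simp add: add_scalar_prod_distrib[of _ n] scalar_prod_add_distrib[of _ n]
      smult_scalar_prod_distrib[of _ n] scalar_prod_smult_distrib[of _ n] algebra_simps power2_eq_square)

text \<open>With \<open>q = a z + p w\<close>, \<open>q' = b z + p w'\<close> and
  \<open>z' = c z + p u\<close>, the claim reduces to \<open>p\<close> dividing
  \<open>z \<bullet> w\<close> and \<open>z \<bullet> w'\<close>. The first follows from
  \<open>zq\<close>. For the second, \<open>zz'\<close> gives that \<open>p\<close> divides
  \<open>2 * c * (z \<bullet> u)\<close>, hence \<open>z \<bullet> u\<close> as \<open>p\<close> is
  odd, and then \<open>zq'\<close> applies. In use, \<open>z\<close>, \<open>q\<close> are columns
  of one matrix and \<open>z'\<close>, \<open>q'\<close> of another.\<close>

lemma prime_square_dvd_scalar_prod: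
  fixes p :: int
  assumes p: "prime p" "odd p"
    and carrier: "z \<in> carrier_vec n" "q \<in> carrier_vec n" "z' \<in> carrier_vec n" "q' \<in> carrier_vec n"
    and zz: "p\<^sup>2 dvd z \<bullet> z" and zq: "p\<^sup>2 dvd z \<bullet> q"
    and zz': "p\<^sup>2 dvd z' \<bullet> z'" and zq': "p\<^sup>2 dvd z' \<bullet> q'"
    and q: "\<And>r. r < n \<Longrightarrow> p dvd q $ r - a * z $ r"
    and q': "\<And>r. r < n \<Longrightarrow> p dvd q' $ r - b * z $ r"
    and z': "\<And>r. r < n \<Longrightarrow> p dvd z' $ r - c * z $ r" and c: "\<not> p dvd c"
  shows "p\<^sup>2 dvd q \<bullet> q'"
proof -
  have p0: "p \<noteq> 0" using p by auto
  have decomp: "\<exists>w \<in> carrier_vec n. x = a \<cdot>\<^sub>v z + p \<cdot>\<^sub>v w"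
    if "x \<in> carrier_vec n" "\<And>r. r < n \<Longrightarrow> p dvd x $ r - a * z $ r" for x a
    using that carrier
    by (intro bexI[of _ "vec n (\<lambda>r. (x $ r - a * z $ r) div p)"] eq_vecI) auto
  obtain w where w: "w \<in> carrier_vec n" "q = a \<cdot>\<^sub>v z + p \<cdot>\<^sub>v w"
    using decomp[OF carrier(2) q] by blast
  obtain w' where w': "w' \<in> carrier_vec n" "q' = b \<cdot>\<^sub>v z + p \<cdot>\<^sub>v w'"
    using decomp[OF carrier(4) q'] by blast
  obtain u where u: "u \<in> carrier_vec n" "z' = c \<cdot>\<^sub>v z + p \<cdot>\<^sub>v u"
    using decomp[OF carrier(3) z'] by blast
  note expand = scalar_prod_perturbed[OF carrier(1)]
  have reduce: "p dvd t" if "p\<^sup>2 dvd s * (z \<bullet> z) + p * t + p\<^sup>2 * v" for s t v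
  proof -
    have "p\<^sup>2 dvd p * t"
      using that zz by (metis dvd_add_left_iff dvd_add_right_iff dvd_mult dvd_triv_left)
    then show ?thesis using p0 by (simp add: power2_eq_square)
  qed
  have "z \<bullet> q = a * (z \<bullet> z) + p * (z \<bullet> w) + p\<^sup>2 * 0"
    using carrier w
    by (simp add: scalar_prod_add_distrib[of _ n] scalar_prod_smult_distrib[of _ n])
  with zq have 1: "p dvd z \<bullet> w" by (intro reduce[of a _ 0]) simp
  have "p dvd c * (z \<bullet> u) + c * (z \<bullet> u)"
    using zz' unfolding u(2) expand[OF u(1) u(1)] by (rule reduce)
  then have "p dvd 2 * (c * (z \<bullet> u))" by simp
  moreover have "\<not> p dvd 2" using p by (metis dvd_refl primes_dvd_imp_eq two_is_prime_nat
        prime_int_numeral_eq)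
  ultimately have 2: "p dvd z \<bullet> u" using p c by (simp add: prime_dvd_mult_iff)
  have "p dvd c * (z \<bullet> w') + b * (z \<bullet> u)"
    using zq' unfolding u(2) w'(2) expand[OF u(1) w'(1)] by (rule reduce)
  with 2 have "p dvd c * (z \<bullet> w')" by (simp add: dvd_add_left_iff)
  then have 3: "p dvd z \<bullet> w'" using p c by (simp add: prime_dvd_mult_iff)
  have "p dvd a * (z \<bullet> w') + b * (z \<bullet> w)" using 1 3 by simp
  then have "p\<^sup>2 dvd p * (a * (z \<bullet> w') + b * (z \<bullet> w))" by (simp add: power2_eq_square)
  then show ?thesis unfolding w(2) w'(2) expand[OF w(1) w'(1)] using zz by simp
qed

text \<open>In each row the entries and their squares both sum to 1. As \<open>t * t - t\<close> is
  nonnegative on integers, all entries are 0 or 1 with a single 1 per row; orthogonality of the rows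
  makes the positions distinct.\<close>

lemma integral_orthogonal_regular_is_permutation:
  fixes M :: "int mat"
  assumes M: "M \<in> carrier_mat n n" and orth: "M * transpose_mat M = 1\<^sub>m n"
    and reg: "M *\<^sub>v all_ones_vec n = all_ones_vec n"
  shows "permutation_mat n M"
proof -
  have sq: "(\<Sum>j = 0..<n. M $$ (i, j) * M $$ (k, j)) = (if i = k then 1 else 0)"
    if "i < n" "k < n" for i k
  proof -
    have "(M * transpose_mat M) $$ (i, k) = (\<Sum>j = 0..<n. M $$ (i, j) * M $$ (k, j))"
      using M that by (simp add: scalar_prod_def)
    with orth that show ?thesis by simp
  qed
  have row_sum: "(\<Sum>j = 0..<n. M $$ (i, j)) = 1" if "i < n" for i
  proof -
    have "(M *\<^sub>v all_ones_vec n) $ i = (\<Sum>j = 0..<n. M $$ (i, j))"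
      using M that by (simp add: scalar_prod_def all_ones_vec_def)
    with reg that show ?thesis by (simp add: all_ones_vec_def)
  qed
  have entries: "M $$ (i, j) = 0 \<or> M $$ (i, j) = 1" if i: "i < n" and j: "j < n" for i j
  proof -
    have nonneg: "M $$ (i, j) * M $$ (i, j) - M $$ (i, j) \<ge> 0" for j
      by (cases "M $$ (i, j) \<le> 0") (auto simp: mult_nonpos_nonpos mult_le_cancel_left1
          intro: order_trans[OF _ mult_nonpos_nonpos])
    have "(\<Sum>j = 0..<n. M $$ (i, j) * M $$ (i, j) - M $$ (i, j)) = 0"
      using sq[OF i i] row_sum[OF i] by (simp add: sum_subtractf)
    then have "M $$ (i, j) * M $$ (i, j) - M $$ (i, j) = 0"
      using nonneg j by (subst (asm) sum_nonneg_eq_0_iff) auto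
    then show ?thesis by auto
  qed
  have "\<exists>j<n. M $$ (i, j) = 1" if i: "i < n" for i
  proof (rule ccontr)
    assume "\<not> (\<exists>j<n. M $$ (i, j) = 1)"
    then have "(\<Sum>j = 0..<n. M $$ (i, j)) = 0" using entries[OF i] by (intro sum.neutral) auto
    with row_sum[OF i] show False by simp
  qed
  then obtain f where f: "\<And>i. i < n \<Longrightarrow> f i < n \<and> M $$ (i, f i) = 1" by metis
  have M_eq: "M $$ (i, j) = (if f i = j then 1 else 0)" if i: "i < n" and j: "j < n" for i j
  proof (cases "f i = j")
    case False
    have "(\<Sum>j\<in>{0..<n} - {f i}. M $$ (i, j)) = 0"
      using row_sum[OF i] f[OF i] by (subst (asm) sum.remove[of _ "f i"]) auto
    moreover have "M $$ (i, j) \<ge> 0" if "j < n" for j using entries[OF i that] by auto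
    ultimately have "\<forall>j\<in>{0..<n} - {f i}. M $$ (i, j) = 0"
      by (subst (asm) sum_nonneg_eq_0_iff) auto
    with False j show ?thesis by auto
  qed (use f[OF i] in auto)
  \<comment> \<open>The identity outside the index range is what \<open>permutes\<close>
    demands.\<close>
  define \<pi> where "\<pi> i = (if i < n then f i else i)" for i
  have "inj_on \<pi> {0..<n}"
  proof
    fix i k assume ik: "i \<in> {0..<n}" "k \<in> {0..<n}" "\<pi> i = \<pi> k"
    then have "f i = f k" by (simp add: \<pi>_def)
    then have "(\<Sum>j = 0..<n. M $$ (i, j) * M $$ (k, j)) = (\<Sum>j = 0..<n. if f i = j then 1 else 0)"
      using ik by (intro sum.cong) (auto simp: M_eq)
    also have "\<dots> = 1" using f[of i] ik by simp
    finally show "i = k" using sq[of i k] ik by (auto split: if_splits)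
  qed
  moreover have "\<pi> ` {0..<n} \<subseteq> {0..<n}" using f by (auto simp: \<pi>_def)
  ultimately have "bij_betw \<pi> {0..<n} {0..<n}"
    by (simp add: bij_betw_def endo_inj_surj)
  then have "\<pi> permutes {0..<n}" by (rule bij_imp_permutes) (auto simp: \<pi>_def)
  moreover have "M = mat n n (\<lambda>(i, j). if \<pi> i = j then 1 else 0)"
    using M by (intro eq_matI) (auto simp: M_eq \<pi>_def)
  ultimately show ?thesis unfolding permutation_mat_def by blast
qed

text \<open>The assumption makes \<open>l\<close> square-free, so \<open>l^2\<close> is a product of
  pairwise coprime prime squares, each dividing \<open>N\<close>. The induction runs over the
  divisors of \<open>l\<close>.\<close>

lemma squarefree_power2_dvd:
  fixes l :: nat and N :: int
  assumes l: "l > 0"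
    and p: "\<And>p. prime p \<Longrightarrow> p dvd l \<Longrightarrow> \<not> p\<^sup>2 dvd l \<and> (int p)\<^sup>2 dvd N"
  shows "(int l)\<^sup>2 dvd N"
proof -
  have "(int m)\<^sup>2 dvd N" if "m dvd l" for m
    using that
  proof (induction m rule: less_induct)
    case (less m)
    show ?case
    proof (cases "m = 1")
      case False
      then obtain q where q: "prime q" "q dvd m" using prime_factor_nat by blast
      then obtain t where t: "m = q * t" by auto
      have m0: "m > 0" using less.prems l by (metis dvd_0_left gr0I)
      have "t < m" using q(1) t m0 prime_gt_1_nat[of q] by auto
      moreover have "t dvd l" using less.prems t by (metis dvd_mult_right)
      ultimately have "(int t)\<^sup>2 dvd N" by (rule less.IH)
      moreover have "q dvd l" using q less.prems by (metis dvd_trans)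
      moreover have "\<not> q dvd t"
      proof
        assume "q dvd t"
        then have "q\<^sup>2 dvd m" by (auto simp: t power2_eq_square)
        with less.prems p[OF q(1) \<open>q dvd l\<close>] show False by (metis dvd_trans)
      qed
      then have "coprime ((int q)\<^sup>2) ((int t)\<^sup>2)"
        using q(1) by (simp add: prime_imp_coprime)
      ultimately have "(int q)\<^sup>2 * (int t)\<^sup>2 dvd N"
        using p[OF q(1)] by (intro divides_mult) auto
      then show ?thesis by (simp add: t power_mult_distrib)
    qed simp
  qed
  then show ?thesis by simp
qed

section \<open>Existence and minimality of the level\<close>

lemma ex_common_denominator:
  fixes F :: "rat set"
  assumes "finite F"
  shows "\<exists>k :: nat. k > 0 \<and> (\<forall>x\<in>F. of_nat k * x \<in> \<int>)"
  using assms
proof (induction F)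
  case empty
  show ?case by (intro exI[of _ 1]) simp
next
  case (insert x F)
  then obtain k :: nat where k: "k > 0" "\<forall>x\<in>F. of_nat k * x \<in> \<int>" by blast
  obtain a b where ab: "quotient_of x = (a, b)" by fastforce
  then have b: "b > 0" and x: "x = of_int a / of_int b"
    by (simp_all add: quotient_of_denom_pos quotient_of_div)
  have bx: "of_nat (nat b) * x \<in> \<int>" using b by (simp add: x)
  have "of_nat (nat b * k) * y \<in> \<int>" if "y \<in> insert x F" for y :: rat
  proof (cases "y = x")
    case True
    have "of_nat k * (of_nat (nat b) * x) \<in> \<int>" by (intro Ints_mult bx) simp
    with True show ?thesis by (simp add: ac_simps)
  next
    case False
    then have "of_nat k * y \<in> \<int>" using k that by simp
    then have "of_nat (nat b) * (of_nat k * y) \<in> \<int>" by (rule Ints_mult[OF Ints_of_nat])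
    then show ?thesis by (simp add: ac_simps)
  qed
  with b k show ?case by (intro exI[of _ "nat b * k"]) auto
qed

text \<open>A common denominator of the entries shows that the \<open>LEAST\<close> in
  \<open>level\<close> ranges over a nonempty set.\<close>

lemma
  assumes Q: "Q \<in> carrier_mat n m"
  shows level_pos: "level Q > 0"
    and integral_level: "integral_mat (of_nat (level Q) \<cdot>\<^sub>m Q)"
proof -
  obtain k :: nat where "k > 0"
    "\<forall>x \<in> (\<lambda>(i, j). Q $$ (i, j)) ` ({..<n} \<times> {..<m}). of_nat k * x \<in> \<int>"
    using ex_common_denominator[of "(\<lambda>(i, j). Q $$ (i, j)) ` ({..<n} \<times> {..<m})"] by auto
  then have "0 < k \<and> integral_mat (of_nat k \<cdot>\<^sub>m Q)"
    using Q by (auto simp: integral_mat_def)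
  then have "0 < level Q \<and> integral_mat (of_nat (level Q) \<cdot>\<^sub>m Q)"
    unfolding level_def by (rule LeastI)
  then show "level Q > 0" "integral_mat (of_nat (level Q) \<cdot>\<^sub>m Q)" by simp_all
qed

text \<open>If \<open>p\<close> divided every entry of \<open>X\<close>, the smaller multiplier
  \<open>level Q div p\<close> would already make \<open>Q\<close> integral.\<close>

lemma level_multiple_primitive:
  fixes X :: "int mat"
  assumes Q: "Q \<in> carrier_mat n m" and X: "X \<in> carrier_mat n m"
    and XQ: "map_mat of_int X = of_nat (level Q) \<cdot>\<^sub>m Q"
    and p: "prime p" "p dvd level Q"
  obtains r i where "r < n" "i < m" "\<not> int p dvd X $$ (r, i)"
proof -
  have "\<exists>r<n. \<exists>i<m. \<not> int p dvd X $$ (r, i)"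
  proof (rule ccontr)
    assume *: "\<not> (\<exists>r<n. \<exists>i<m. \<not> int p dvd X $$ (r, i))"
    obtain t where t: "level Q = p * t" using p by auto
    have t0: "t > 0" using level_pos[OF Q] t by (intro gr0I) simp
    have "of_nat t * Q $$ (r, i) \<in> \<int>" if ri: "r < n" "i < m" for r i
    proof -
      obtain s where s: "X $$ (r, i) = int p * s" using * ri by blast
      have "map_mat of_int X $$ (r, i) = (of_nat (level Q) \<cdot>\<^sub>m Q) $$ (r, i)" using XQ by simp
      then have "(of_nat p :: rat) * of_int s = of_nat p * (of_nat t * Q $$ (r, i))"
        using X Q ri by (simp add: s t mult.assoc)
      then have "of_nat t * Q $$ (r, i) = of_int s" using prime_gt_0_nat[OF p(1)] by simp
      then show ?thesis by simp
    qed
    then have "0 < t \<and> integral_mat (of_nat t \<cdot>\<^sub>m Q)" using Q t0 by (simp add: integral_mat_def)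
    then have "level Q \<le> t" unfolding level_def by (rule Least_le)
    with t t0 prime_gt_1_nat[OF p(1)] show False by simp
  qed
  with that show ?thesis by blast
qed

lemma integral_mat_obtain:
  assumes "integral_mat R" and R: "R \<in> carrier_mat n m"
  obtains X :: "int mat" where "X \<in> carrier_mat n m" "map_mat of_int X = R"
proof
  show "mat n m (\<lambda>ij. \<lfloor>R $$ ij\<rfloor>) \<in> carrier_mat n m" by simp
  have "of_int \<lfloor>x\<rfloor> = x" if "x \<in> \<int>" for x :: rat using that by (auto elim: Ints_cases)
  then show "map_mat of_int (mat n m (\<lambda>ij. \<lfloor>R $$ ij\<rfloor>)) = R"
    using assms by (intro eq_matI) (auto simp: integral_mat_def)
qed

subsection \<open>Scaled similarities\<close>

text \<open>The conditions on the regular orthogonal matrix \<open>X / l\<close> with denominators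
  cleared, so that divisibility arguments take place over the integers. Regularity is stated for the
  transpose, which is the matrix acting on walk vectors.\<close>

definition scaled_similarity :: "nat \<Rightarrow> int mat \<Rightarrow> int mat \<Rightarrow> int \<Rightarrow> int mat \<Rightarrow> bool" where
  "scaled_similarity n A B l X \<longleftrightarrow> X \<in> carrier_mat n n \<and> transpose_mat X * X = l\<^sup>2 \<cdot>\<^sub>m 1\<^sub>m n \<and>
     A * X = X * B \<and> transpose_mat X *\<^sub>v all_ones_vec n = l \<cdot>\<^sub>v all_ones_vec n"

lemma skew_adj_carrier [simp]: "skew_adj n D \<in> carrier_mat n n"
  by (simp add: skew_adj_def)

lemma transpose_skew_adj: "oriented_graph n D \<Longrightarrow> transpose_mat (skew_adj n D) = - skew_adj n D"
  by (intro eq_matI) (auto simp: skew_adj_def oriented_graph_def)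

lemma scaled_similarityI:
  assumes A: "A \<in> carrier_mat n n" and B: "B \<in> carrier_mat n n"
    and Q: "rat_orthogonal n Q" and reg: "regular_mat n Q"
    and sim: "transpose_mat Q * map_mat of_int A * Q = map_mat of_int B"
    and X: "X \<in> carrier_mat n n" and XQ: "map_mat of_int X = of_nat l \<cdot>\<^sub>m Q"
  shows "scaled_similarity n A B (int l) X"
proof -
  let ?r = "map_mat (of_int :: int \<Rightarrow> rat)"
  have Qc: "Q \<in> carrier_mat n n" and QQ: "transpose_mat Q * Q = 1\<^sub>m n"
    using Q by (simp_all add: rat_orthogonal_def)
  have QQ': "Q * transpose_mat Q = 1\<^sub>m n"
    using mat_mult_left_right_inverse[OF _ Qc QQ] Qc by simp
  have rA: "?r A \<in> carrier_mat n n" and rB: "?r B \<in> carrier_mat n n" using A B by simp_all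
  \<comment> \<open>Inserting \<open>Q * transpose_mat Q\<close> turns the congruence into an
    intertwining relation, which passes to all powers.\<close>
  have "?r A * Q = (Q * transpose_mat Q) * (?r A * Q)"
    unfolding QQ' using rA Qc by simp
  also have "\<dots> = Q * ?r B"
    unfolding sim[symmetric] using rA Qc by (simp add: assoc_mult_mat[of _ n n _ n _ n])
  finally have AQ: "?r A * Q = Q * ?r B" .
  have "transpose_mat Q *\<^sub>v all_ones_vec n = (transpose_mat Q * Q) *\<^sub>v all_ones_vec n"
    using reg Qc by (simp add: regular_mat_def assoc_mult_mat_vec[of _ n n _ n])
  then have Qe: "transpose_mat Q *\<^sub>v all_ones_vec n = all_ones_vec n" by (simp add: QQ)
  have 1: "transpose_mat X * X = (int l)\<^sup>2 \<cdot>\<^sub>m 1\<^sub>m n"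
  proof (rule of_int_hom.mat_hom_inj[where ?'a = rat])
    have "?r (transpose_mat X * X) = transpose_mat (?r X) * ?r X"
      using X by (simp add: of_int_hom.mat_hom_mult[of _ n n _ n] map_mat_transpose)
    also have "\<dots> = (of_nat l)\<^sup>2 \<cdot>\<^sub>m (transpose_mat Q * Q)"
      unfolding XQ using Qc
      by (intro eq_matI) (auto simp: power2_eq_square)
    also have "\<dots> = ?r ((int l)\<^sup>2 \<cdot>\<^sub>m 1\<^sub>m n)"
      unfolding QQ by (intro eq_matI) auto
    finally show "?r (transpose_mat X * X) = ?r ((int l)\<^sup>2 \<cdot>\<^sub>m 1\<^sub>m n)" .
  qed
  have 2: "A * X = X * B"
  proof (rule of_int_hom.mat_hom_inj[where ?'a = rat])
    have "?r (A * X) = of_nat l \<cdot>\<^sub>m (?r A * Q)"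
      using A X Qc by (simp add: of_int_hom.mat_hom_mult[of _ n n _ n] XQ mult_smult_distrib[of _ n n _ n])
    also have "\<dots> = ?r (X * B)"
      unfolding AQ using B X Qc
      by (simp add: of_int_hom.mat_hom_mult[of _ n n _ n] XQ mult_smult_assoc_mat[of _ n n _ n])
    finally show "?r (A * X) = ?r (X * B)" .
  qed
  have "transpose_mat X *\<^sub>v all_ones_vec n = int l \<cdot>\<^sub>v all_ones_vec n"
  proof (rule eq_vecI)
    fix i assume "i < dim_vec (int l \<cdot>\<^sub>v all_ones_vec n)"
    then have i: "i < n" by (simp add: all_ones_vec_def)
    have "(of_int ((transpose_mat X *\<^sub>v all_ones_vec n) $ i) :: rat)
        = (\<Sum>j = 0..<n. ?r X $$ (j, i))"
      using X i by (simp add: scalar_prod_def all_ones_vec_def)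
    also have "\<dots> = of_nat l * (transpose_mat Q *\<^sub>v all_ones_vec n) $ i"
      unfolding XQ using Qc i by (simp add: scalar_prod_def all_ones_vec_def sum_distrib_left)
    also have "\<dots> = of_int ((int l \<cdot>\<^sub>v all_ones_vec n) $ i)"
      unfolding Qe using i by (simp add: all_ones_vec_def)
    finally show "(transpose_mat X *\<^sub>v all_ones_vec n) $ i = (int l \<cdot>\<^sub>v all_ones_vec n) $ i"
      by (simp only: of_int_eq_iff)
  qed (use X in \<open>simp add: all_ones_vec_def\<close>)
  with 1 2 X show ?thesis by (simp add: scaled_similarity_def)
qed

context
  fixes n :: nat and A B :: "int mat" and l :: int and X :: "int mat"
  assumes A: "A \<in> carrier_mat n n" and B: "B \<in> carrier_mat n n"
    and skewA: "transpose_mat A = - A" and skewB: "transpose_mat B = - B"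
    and sim: "scaled_similarity n A B l X"
begin

lemma similarity_carrier: "X \<in> carrier_mat n n"
  using sim by (simp add: scaled_similarity_def)

lemma similarity_col_scalar_prod:
  assumes "i < n" "j < n"
  shows "col X i \<bullet> col X j = (if i = j then l\<^sup>2 else 0)"
proof -
  have "col X i \<bullet> col X j = (transpose_mat X * X) $$ (i, j)"
    using assms similarity_carrier by simp
  also have "\<dots> = (if i = j then l\<^sup>2 else 0)"
    using assms sim by (simp add: scaled_similarity_def)
  finally show ?thesis .
qed

lemma similarity_orbit:
  assumes y: "y \<in> carrier_vec n"
  shows "orbit A (X *\<^sub>v y) k = X *\<^sub>v orbit B y k"
proof (induction k)
  case 0
  show ?case using A B y similarity_carrier by simp
next
  case (Suc k)
  have Xc: "X \<in> carrier_mat n n" by (rule similarity_carrier)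
  have o: "orbit B y k \<in> carrier_vec n" using B y by simp
  have "orbit A (X *\<^sub>v y) (Suc k) = (A * X) *\<^sub>v orbit B y k"
    using A y Xc o by (simp add: orbit_Suc[of _ n] Suc.IH assoc_mult_mat_vec[of _ n n _ n])
  also have "A * X = X * B" using sim by (simp add: scaled_similarity_def)
  also have "(X * B) *\<^sub>v orbit B y k = X *\<^sub>v orbit B y (Suc k)"
    using B y Xc o by (simp add: orbit_Suc[of _ n] assoc_mult_mat_vec[of _ n n _ n])
  finally show ?case .
qed

text \<open>The iterate of column \<open>i\<close> is \<open>X\<close> applied to an iterate of a
  unit vector under \<open>B\<close>, and \<open>X\<close> multiplies squared norms by
  \<open>l^2\<close>.\<close>

lemma similarity_dvd_orbit_norm:
  assumes i: "i < n"
  shows "l\<^sup>2 dvd orbit A (col X i) k \<bullet> orbit A (col X i) k"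
proof -
  have Xc: "X \<in> carrier_mat n n" by (rule similarity_carrier)
  define u where "u = orbit B (unit_vec n i) k"
  have u: "u \<in> carrier_vec n" using B by (simp add: u_def)
  have Xu: "X *\<^sub>v u \<in> carrier_vec n" using Xc u by (rule mult_mat_vec_carrier)
  have Xi: "X *\<^sub>v unit_vec n i = col X i" using Xc i by (intro eq_vecI) auto
  have "orbit A (col X i) k = X *\<^sub>v u"
    using similarity_orbit[of "unit_vec n i" k] Xi by (simp add: u_def)
  moreover have "(X *\<^sub>v u) \<bullet> (X *\<^sub>v u) = (transpose_mat X *\<^sub>v (X *\<^sub>v u)) \<bullet> u"
    using Xc u Xu by (simp add: transpose_vec_mult_scalar)
  moreover have "transpose_mat X *\<^sub>v (X *\<^sub>v u) = (transpose_mat X * X) *\<^sub>v u"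
    using Xc u by (simp add: assoc_mult_mat_vec[of _ n n _ n])
  moreover have "\<dots> = l\<^sup>2 \<cdot>\<^sub>v u"
    using sim u by (auto simp: scaled_similarity_def intro!: eq_vecI)
  ultimately show ?thesis using u by simp
qed

text \<open>Transposing \<open>A * X = X * B\<close> gives
  \<open>transpose_mat X * A = B * transpose_mat X\<close>, as the two signs from skewness
  cancel.\<close>

lemma similarity_transpose_walk:
  "transpose_mat X *\<^sub>v orbit A (all_ones_vec n) k = l \<cdot>\<^sub>v orbit B (all_ones_vec n) k"
proof (induction k)
  case 0
  show ?case using A B sim by (simp add: scaled_similarity_def)
next
  case (Suc k)
  have Xc: "X \<in> carrier_mat n n" by (rule similarity_carrier)
  have XT: "transpose_mat X \<in> carrier_mat n n" using Xc by simp
  have oA: "orbit A (all_ones_vec n) k \<in> carrier_vec n"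
    and oB: "orbit B (all_ones_vec n) k \<in> carrier_vec n" using A B by simp_all
  have "transpose_mat (A * X) = transpose_mat (X * B)" using sim by (simp add: scaled_similarity_def)
  then have "transpose_mat X * (- A) = - B * transpose_mat X"
    using A B Xc by (simp add: transpose_mult[of _ n n _ n] skewA skewB)
  then have "- (transpose_mat X * A) = - (B * transpose_mat X)"
    using A B Xc by simp
  then have comm: "transpose_mat X * A = B * transpose_mat X"
    by (metis uminus_uminus_mat)
  have "transpose_mat X *\<^sub>v orbit A (all_ones_vec n) (Suc k)
      = (transpose_mat X * A) *\<^sub>v orbit A (all_ones_vec n) k"
    using A XT oA by (simp add: orbit_Suc[of _ n] assoc_mult_mat_vec[of _ n n _ n])
  also have "\<dots> = B *\<^sub>v (transpose_mat X *\<^sub>v orbit A (all_ones_vec n) k)"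
    unfolding comm using B XT oA by (rule assoc_mult_mat_vec)
  also have "\<dots> = l \<cdot>\<^sub>v orbit B (all_ones_vec n) (Suc k)"
    unfolding Suc.IH using B oB by (intro eq_vecI) (auto simp: orbit_Suc[of _ n])
  finally show ?case .
qed

lemma similarity_dvd_scalar_prod_walk:
  assumes i: "i < n"
  shows "l dvd col X i \<bullet> orbit A (all_ones_vec n) k"
proof -
  have "col X i \<bullet> orbit A (all_ones_vec n) k
      = (transpose_mat X *\<^sub>v orbit A (all_ones_vec n) k) $ i"
    using i similarity_carrier by simp
  also have "\<dots> = l * orbit B (all_ones_vec n) k $ i"
    unfolding similarity_transpose_walk using i B by simp
  finally show ?thesis by simp
qed

end

section \<open>Primes dividing the level and the walk matrix\<close>

lemma dvd_det_mult:
  fixes A :: "'a :: comm_ring_1 mat"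
  assumes A: "A \<in> carrier_mat n n" and x: "x \<in> carrier_vec n" and r: "r < n"
    and dvd: "\<And>k. k < n \<Longrightarrow> m dvd (A *\<^sub>v x) $ k"
  shows "m dvd x $ r * det A"
proof -
  let ?C = "replace_col A (A *\<^sub>v x) r"
  \<comment> \<open>Column \<open>r\<close> of \<open>?C\<close> is divisible by \<open>m\<close>,
    and Cramer's rule evaluates \<open>det ?C\<close> as \<open>x $ r * det A\<close>.\<close>
  have "(\<Prod>i = 0..<n. 1) * (\<Prod>j = 0..<n. if j = r then m else 1) dvd det ?C"
    using A dvd by (intro prod_dvd_det) (auto simp: replace_col_def)
  then show ?thesis using r by (simp add: prod.delta cramer_lemma_mat[OF A x r])
qed

lemma walk_mat_eq: "walk_mat n S = mat n n (\<lambda>(i, j). orbit (skew_adj n S) (all_ones_vec n) j $ i)"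
  by (simp add: walk_mat_def orbit_def)

lemma col_walk_mat: "j < n \<Longrightarrow> col (walk_mat n S) j = orbit (skew_adj n S) (all_ones_vec n) j"
  by (intro eq_vecI) (auto simp: walk_mat_eq skew_adj_def)

lemma G_classE:
  assumes "S \<in> G_class n"
  obtains d where "oriented_graph n S" "det (walk_mat n S) = 2 ^ (n div 2) * d" "odd d" "squarefree d"
  using assms by (auto simp: G_class_def)

text \<open>For \<open>p = 2\<close>, column \<open>i\<close> of \<open>X\<close> would meet the
  conditions of \<open>even_of_isotropic_orbit\<close> in spite of its odd entry. For odd
  \<open>p\<close>, the square-free part of the walk determinant excludes \<open>p^2\<close>.
  Finally \<open>l\<close> divides \<open>X $$ (r, i)\<close> times that determinant, so
  \<open>p^2\<close> cannot divide \<open>l\<close>.\<close>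

lemma prime_dvd_level:
  assumes S: "S \<in> G_class n" and B: "B \<in> carrier_mat n n" "transpose_mat B = - B"
    and sim: "scaled_similarity n (skew_adj n S) B (int l) X"
    and p: "prime p" "p dvd l" and nz: "r < n" "i < n" "\<not> int p dvd X $$ (r, i)"
  shows "odd p" "\<not> (int p)\<^sup>2 dvd det (walk_mat n S)" "\<not> p\<^sup>2 dvd l"
proof -
  obtain d where og: "oriented_graph n S" and det: "det (walk_mat n S) = 2 ^ (n div 2) * d"
    and d: "odd d" "squarefree d" by (rule G_classE[OF S])
  let ?A = "skew_adj n S"
  note hyps = skew_adj_carrier B(1) transpose_skew_adj[OF og] B(2) sim
  have X: "X \<in> carrier_mat n n" by (rule similarity_carrier[OF hyps])
  have Xi: "col X i \<in> carrier_vec n" "col X i $ r = X $$ (r, i)" using X nz by auto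
  have pl: "int p dvd int l" using p by simp
  show odd: "odd p"
  proof
    assume "even p"
    then have p2: "p = 2" using p(1) by (metis prime_nat_iff primes_dvd_imp_eq two_is_prime_nat)
    have "even (col X i $ r)"
    proof (rule even_of_isotropic_orbit[OF skew_adj_carrier transpose_skew_adj[OF og] _ d(1) Xi(1) _ _ nz(1)])
      show "det (mat n n (\<lambda>(i, j). orbit ?A (all_ones_vec n) j $ i)) = 2 ^ (n div 2) * d"
        using det by (simp add: walk_mat_eq)
      show "even (col X i \<bullet> orbit ?A (all_ones_vec n) k)" for k
        using dvd_trans[OF pl similarity_dvd_scalar_prod_walk[OF hyps nz(2), of k]] p2 by simp
      show "4 dvd orbit ?A (col X i) k \<bullet> orbit ?A (col X i) k" for k
      proof -
        have "(2::int)\<^sup>2 dvd (int l)\<^sup>2" using pl p2 by (intro dvd_power_same) simp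
        also note similarity_dvd_orbit_norm[OF hyps nz(2), of k]
        finally show ?thesis by simp
      qed
    qed
    with nz p2 Xi show False by simp
  qed
  have pp: "prime (int p)" using p by simp
  show det': "\<not> (int p)\<^sup>2 dvd det (walk_mat n S)"
  proof
    assume "(int p)\<^sup>2 dvd det (walk_mat n S)"
    moreover have "coprime ((int p)\<^sup>2) (2 ^ (n div 2))" using odd by simp
    ultimately have "(int p)\<^sup>2 dvd d" unfolding det by (simp add: coprime_dvd_mult_right_iff)
    with d(2) have "is_unit (int p)" by (rule squarefreeD)
    with pp show False by (simp add: not_prime_unit)
  qed
  show "\<not> p\<^sup>2 dvd l"
  proof
    assume *: "p\<^sup>2 dvd l"
    have W: "transpose_mat (walk_mat n S) \<in> carrier_mat n n" by (simp add: walk_mat_def)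
    have "int l dvd col X i $ r * det (transpose_mat (walk_mat n S))"
    proof (rule dvd_det_mult[OF W Xi(1) nz(1)])
      fix k assume k: "k < n"
      have "(transpose_mat (walk_mat n S) *\<^sub>v col X i) $ k
          = orbit ?A (all_ones_vec n) k \<bullet> col X i"
        using k W by (simp add: col_walk_mat)
      also have "\<dots> = col X i \<bullet> orbit ?A (all_ones_vec n) k"
        using Xi by (intro comm_scalar_prod[of _ n]) auto
      finally show "int l dvd (transpose_mat (walk_mat n S) *\<^sub>v col X i) $ k"
        using similarity_dvd_scalar_prod_walk[OF hyps nz(2), of k] by simp
    qed
    moreover have "(int p)\<^sup>2 dvd int l" using * by (metis of_nat_dvd_iff of_nat_power)
    ultimately have "(int p)\<^sup>2 dvd X $$ (r, i) * det (walk_mat n S)"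
      using Xi W by (metis det_transpose dvd_trans transpose_carrier_mat)
    moreover have "coprime ((int p)\<^sup>2) (X $$ (r, i))" using pp nz(3) by (simp add: prime_imp_coprime)
    ultimately show False using det' by (simp add: coprime_dvd_mult_right_iff)
  qed
qed

text \<open>Each prime divisor of \<open>l\<close> is treated separately, and the results combine
  because \<open>l\<close> is square-free. The primitivity assumptions supply a column of
  \<open>X\<close> and one of \<open>Y\<close> that are nonzero modulo the prime.\<close>

lemma level_square_dvd_scalar_prod:
  assumes S: "S \<in> G_class n" and l: "l > 0"
    and B: "B \<in> carrier_mat n n" "transpose_mat B = - B"
    and C: "C \<in> carrier_mat n n" "transpose_mat C = - C"
    and X: "scaled_similarity n (skew_adj n S) B (int l) X"
    and Y: "scaled_similarity n (skew_adj n S) C (int l) Y"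
    and primX: "\<And>p. prime p \<Longrightarrow> p dvd l \<Longrightarrow> \<exists>r<n. \<exists>i<n. \<not> int p dvd X $$ (r, i)"
    and primY: "\<And>p. prime p \<Longrightarrow> p dvd l \<Longrightarrow> \<exists>r<n. \<exists>i<n. \<not> int p dvd Y $$ (r, i)"
    and i: "i < n" and j: "j < n"
  shows "(int l)\<^sup>2 dvd col X i \<bullet> col Y j"
proof (rule squarefree_power2_dvd[OF l])
  fix p assume p: "prime p" "p dvd l"
  obtain r s where rs: "r < n" "s < n" "\<not> int p dvd X $$ (r, s)" using primX[OF p] by blast
  obtain r' s' where rs': "r' < n" "s' < n" "\<not> int p dvd Y $$ (r', s')" using primY[OF p] by blast
  note facts = prime_dvd_level[OF S B X p rs]
  obtain og: "oriented_graph n S" by (rule G_classE[OF S])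
  note hX = skew_adj_carrier B(1) transpose_skew_adj[OF og] B(2) X
  note hY = skew_adj_carrier C(1) transpose_skew_adj[OF og] C(2) Y
  have Xc: "X \<in> carrier_mat n n" by (rule similarity_carrier[OF hX])
  have Yc: "Y \<in> carrier_mat n n" by (rule similarity_carrier[OF hY])
  have cX: "col X t \<in> carrier_vec n" and cY: "col Y t \<in> carrier_vec n" for t
    using Xc Yc by auto
  have pp: "prime (int p)" and pl: "int p dvd int l" using p by simp_all
  then have pl2: "(int p)\<^sup>2 dvd (int l)\<^sup>2" by (intro dvd_power_same)
  have Wc: "walk_mat n S \<in> carrier_mat n n" by (simp add: walk_mat_def)
  have kerX: "int p dvd col X t \<bullet> col (walk_mat n S) k" if "t < n" "k < n" for t k
    using dvd_trans[OF pl similarity_dvd_scalar_prod_walk[OF hX that(1), of k]] that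
    by (simp add: col_walk_mat)
  have kerY: "int p dvd col Y t \<bullet> col (walk_mat n S) k" if "t < n" "k < n" for t k
    using dvd_trans[OF pl similarity_dvd_scalar_prod_walk[OF hY that(1), of k]] that
    by (simp add: col_walk_mat)
  let ?z = "col X s" and ?z' = "col Y s'"
  have z: "\<not> int p dvd ?z $ r" using rs Xc by simp
  \<comment> \<open>The column \<open>?z\<close> is nonzero modulo \<open>p\<close>, so it generates
    the kernel line, which also contains the columns of \<open>Y\<close>.\<close>
  have multiple: "\<exists>a. \<forall>r<n. int p dvd x $ r - a * ?z $ r"
    if "x \<in> carrier_vec n" "\<And>k. k < n \<Longrightarrow> int p dvd x \<bullet> col (walk_mat n S) k" for x
    by (rule left_kernel_mod_prime[OF pp Wc facts(2) cX that(1) _ _ rs(1) z])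
      (use kerX that rs in auto)
  obtain a where a: "\<And>r. r < n \<Longrightarrow> int p dvd col X i $ r - a * ?z $ r"
    using multiple[OF cX kerX[OF i]] by blast
  obtain b where b: "\<And>r. r < n \<Longrightarrow> int p dvd col Y j $ r - b * ?z $ r"
    using multiple[OF cY kerY[OF j]] by blast
  obtain c where c: "\<And>r. r < n \<Longrightarrow> int p dvd ?z' $ r - c * ?z $ r"
    using multiple[OF cY kerY[OF rs'(2)]] by blast
  have c': "\<not> int p dvd c"
  proof
    assume "int p dvd c"
    then have "int p dvd (?z' $ r' - c * ?z $ r') + c * ?z $ r'"
      using c[OF rs'(1)] by (intro dvd_add) auto
    with rs' Yc show False by simp
  qed
  have "(int p)\<^sup>2 dvd col X i \<bullet> col Y j"
    using pl2
    by (intro prime_square_dvd_scalar_prod[OF pp _ cX cX cY cY _ _ _ _ a b c c'])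
      (auto simp: facts similarity_col_scalar_prod[OF hX] similarity_col_scalar_prod[OF hY] rs rs' i j)
  with facts(3) show "\<not> p\<^sup>2 dvd l \<and> (int p)\<^sup>2 dvd col X i \<bullet> col Y j" by simp
qed

section \<open>Integrality of the transition matrix and the isomorphism\<close>

theorem theorem1p5:
  fixes n :: nat and S D G :: "(nat \<times> nat) set" and Q Q1 :: "rat mat" and l :: nat
  assumes "S \<in> G_class n" and "D \<in> G_class n" and "G \<in> G_class n"
    and "gen_cospectral n S D" and "gen_cospectral n S G" and "gen_cospectral n D G"
    and "Q \<in> Q_set n S" and "Q1 \<in> Q_set n S"
    and "level Q = l" and "level Q1 = l"
    and "transpose_mat Q * map_mat of_int (skew_adj n S) * Q = map_mat of_int (skew_adj n D)"
    and "transpose_mat Q1 * map_mat of_int (skew_adj n S) * Q1 = map_mat of_int (skew_adj n G)"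
  shows "iso_og n D G"
proof -
  let ?r = "map_mat (of_int :: int \<Rightarrow> rat)"
  let ?A = "?r (skew_adj n S)"
  have Q: "rat_orthogonal n Q" "regular_mat n Q" and Q1: "rat_orthogonal n Q1" "regular_mat n Q1"
    using assms(7,8) by (simp_all add: Q_set_def)
  then have Qc: "Q \<in> carrier_mat n n" "transpose_mat Q * Q = 1\<^sub>m n"
    and Q1c: "Q1 \<in> carrier_mat n n" "transpose_mat Q1 * Q1 = 1\<^sub>m n"
    by (simp_all add: rat_orthogonal_def)
  have Q1Q1: "Q1 * transpose_mat Q1 = 1\<^sub>m n"
    using mat_mult_left_right_inverse[OF _ Q1c] Q1c by simp
  have skewD: "transpose_mat (skew_adj n D) = - skew_adj n D"
    and skewG: "transpose_mat (skew_adj n G) = - skew_adj n G"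
    using assms(2,3) by (auto simp: G_class_def intro: transpose_skew_adj)
  obtain X where X: "X \<in> carrier_mat n n" "?r X = of_nat (level Q) \<cdot>\<^sub>m Q"
    using integral_mat_obtain[OF integral_level[OF Qc(1)], of n n] Qc by auto
  obtain Y where Y: "Y \<in> carrier_mat n n" "?r Y = of_nat (level Q1) \<cdot>\<^sub>m Q1"
    using integral_mat_obtain[OF integral_level[OF Q1c(1)], of n n] Q1c by auto
  have l: "l > 0" using level_pos[OF Qc(1)] assms(9) by simp
  have sX: "scaled_similarity n (skew_adj n S) (skew_adj n D) (int l) X"
    using scaled_similarityI[OF _ _ Q assms(11) X] assms(9) by simp
  have sY: "scaled_similarity n (skew_adj n S) (skew_adj n G) (int l) Y"
    using scaled_similarityI[OF _ _ Q1 assms(12) Y] assms(10) by simp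
  have "(int l)\<^sup>2 dvd col Y j \<bullet> col X i" if "i < n" "j < n" for i j
  \<comment> \<open>The lemma is applied with \<open>Y\<close> as its first matrix and
    \<open>X\<close> as its second.\<close>
  proof (rule level_square_dvd_scalar_prod[OF assms(1) l _ skewG _ skewD sY sX _ _ that(2,1)])
    show "\<exists>r<n. \<exists>i<n. \<not> int p dvd X $$ (r, i)" if "prime p" "p dvd l" for p
      using level_multiple_primitive[OF Qc(1) X that(1)] that assms(9) by metis
    show "\<exists>r<n. \<exists>i<n. \<not> int p dvd Y $$ (r, i)" if "prime p" "p dvd l" for p
      using level_multiple_primitive[OF Q1c(1) Y that(1)] that assms(10) by metis
  qed simp_all
  then have dvd: "(int l)\<^sup>2 dvd (transpose_mat Y * X) $$ (j, i)" if "i < n" "j < n" for i j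
    using that X Y by simp
  \<comment> \<open>The division is exact by \<open>dvd\<close>; \<open>M\<close> is the integral
    form of \<open>transpose_mat Q1 * Q\<close>.\<close>
  define M where "M = mat n n (\<lambda>ij. (transpose_mat Y * X) $$ ij div (int l)\<^sup>2)"
  have M: "M \<in> carrier_mat n n" by (simp add: M_def)
  have YX: "transpose_mat Y * X = (int l)\<^sup>2 \<cdot>\<^sub>m M"
    using X Y dvd by (intro eq_matI) (auto simp: M_def simp del: index_mult_mat(1))
  have rM: "?r M = transpose_mat Q1 * Q"
  proof -
    have "(of_nat l)\<^sup>2 \<cdot>\<^sub>m ?r M = ?r (transpose_mat Y * X)"
      unfolding YX by (intro eq_matI) auto
    also have "\<dots> = transpose_mat (?r Y) * ?r X"
      using X(1) Y(1) by (simp add: of_int_hom.mat_hom_mult[of _ n n _ n] map_mat_transpose)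
    also have "\<dots> = (of_nat l)\<^sup>2 \<cdot>\<^sub>m (transpose_mat Q1 * Q)"
      unfolding X(2) Y(2) assms(9,10) using Qc Q1c by (intro eq_matI) (auto simp: power2_eq_square)
    finally have eq: "(of_nat l)\<^sup>2 \<cdot>\<^sub>m ?r M = (of_nat l)\<^sup>2 \<cdot>\<^sub>m (transpose_mat Q1 * Q)" .
    show ?thesis
    proof (rule eq_matI)
      fix i j assume ij: "i < dim_row (transpose_mat Q1 * Q)" "j < dim_col (transpose_mat Q1 * Q)"
      then have "(of_nat l)\<^sup>2 * ?r M $$ (i, j) = (of_nat l)\<^sup>2 * (transpose_mat Q1 * Q) $$ (i, j)"
        using arg_cong[OF eq, of "\<lambda>Z. Z $$ (i, j)"] M Qc Q1c by simp
      then show "?r M $$ (i, j) = (transpose_mat Q1 * Q) $$ (i, j)" using l by simp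
    qed (use M Qc Q1c in auto)
  qed
  have assoc: "U * V * Z = U * (V * Z)"
    if "U \<in> carrier_mat n n" "V \<in> carrier_mat n n" "Z \<in> carrier_mat n n" for U V Z :: "rat mat"
    using that by (rule assoc_mult_mat)
  have Q1M: "Q1 * (transpose_mat Q1 * Q) = Q"
    using Qc Q1c Q1Q1 by (simp flip: assoc)
  have QQ: "Q * transpose_mat Q = 1\<^sub>m n"
    using mat_mult_left_right_inverse[OF _ Qc] Qc by simp
  have QQ1: "Q * (transpose_mat Q * Q1) = Q1"
    using Qc Q1c QQ by (simp flip: assoc)
  have orth: "M * transpose_mat M = 1\<^sub>m n"
  proof (rule of_int_hom.mat_hom_inj[where ?'a = rat])
    have "?r (M * transpose_mat M) = (transpose_mat Q1 * Q) * transpose_mat (transpose_mat Q1 * Q)"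
      using M by (simp add: of_int_hom.mat_hom_mult[of _ n n _ n] map_mat_transpose flip: rM)
    also have "\<dots> = transpose_mat Q1 * (Q * (transpose_mat Q * Q1))"
      using Qc Q1c by (simp add: transpose_mult[of _ n n _ n] assoc)
    also have "\<dots> = ?r (1\<^sub>m n)" unfolding QQ1 Q1c(2) by (intro eq_matI) auto
    finally show "?r (M * transpose_mat M) = ?r (1\<^sub>m n)" .
  qed
  have "permutation_mat n M"
  proof (rule integral_orthogonal_regular_is_permutation[OF M orth])
    show "M *\<^sub>v all_ones_vec n = all_ones_vec n"
    proof (rule of_int_hom.vec_hom_inj[where ?'a = rat])
      have one: "map_vec of_int (all_ones_vec n :: int vec) = (all_ones_vec n :: rat vec)"
        by (intro eq_vecI) (auto simp: all_ones_vec_def)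
      have "map_vec of_int (M *\<^sub>v all_ones_vec n) = (transpose_mat Q1 * Q) *\<^sub>v all_ones_vec n"
        by (subst of_int_hom.mult_mat_vec_hom[OF M all_ones_vec_carrier]) (simp only: one rM)
      also have "\<dots> = transpose_mat Q1 *\<^sub>v (Q1 *\<^sub>v all_ones_vec n)"
        using Q(2) Q1(2) Qc Q1c by (simp add: assoc_mult_mat_vec[of _ n n _ n] regular_mat_def)
      also have "\<dots> = all_ones_vec n"
        using Q1c by (simp flip: assoc_mult_mat_vec[of _ n n _ n])
      finally show "map_vec of_int (M *\<^sub>v all_ones_vec n) = (map_vec of_int (all_ones_vec n) :: rat vec)"
        by (simp add: one)
    qed
  qed
  \<comment> \<open>Since \<open>Q1 * (transpose_mat Q1 * Q) = Q\<close>, conjugation by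
    \<open>M\<close> passes from \<open>G\<close> back to \<open>S\<close> and on to
    \<open>D\<close>.\<close>
  moreover have "skew_adj n D = transpose_mat M * skew_adj n G * M"
  proof (rule of_int_hom.mat_hom_inj[where ?'a = rat])
    have A: "?A \<in> carrier_mat n n" by simp
    have "?r (transpose_mat M * skew_adj n G * M)
        = transpose_mat (?r M) * ?r (skew_adj n G) * ?r M"
      using M by (simp add: of_int_hom.mat_hom_mult[of _ n n _ n] map_mat_transpose
          mult_carrier_mat[of _ n n])
    also have "\<dots> = transpose_mat (transpose_mat Q1 * Q) * (transpose_mat Q1 * ?A * Q1)
        * (transpose_mat Q1 * Q)"
      unfolding rM assms(12) ..
    also have "\<dots> = transpose_mat (Q1 * (transpose_mat Q1 * Q)) * ?A * (Q1 * (transpose_mat Q1 * Q))"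
      using Qc Q1c A by (simp add: transpose_mult[of _ n n _ n] assoc mult_carrier_mat[of _ n n])
    also have "\<dots> = ?r (skew_adj n D)"
      unfolding Q1M by (rule assms(11))
    finally show "?r (skew_adj n D) = ?r (transpose_mat M * skew_adj n G * M)" ..
  qed
  ultimately show ?thesis unfolding iso_og_def by blast
qed

end
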